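(* Let $(Y,y_0)$ be a pointed algebraic variety over a field $\mathbb K$, $S$ a countable unital abelian semigroup of finite endomorphisms of $(Y,y_0)$ unramified over $y_0$, and let $X=\varprojlim_{s\in S}X_s$ with projections $\xi_s:X\to X_s$, and the open and closed subsets $X^{e_s}\subset X$, be as in the context. Then $S$ acts on the projective limit $X$ by partial isomorphisms $\beta_s:X\to X^{e_s}$ (that is, each $\beta_s$ is an isomorphism of $X$ onto $X^{e_s}$), defined by the property that $$\xi_{su}(\beta_s(x))=\xi_u(x)\qquad\forall u\in S,\ \forall x\in X .$$
   Context: Each $s\in S$ satisfies $s(y_0)=y_0$. For $s\in S$ put $X_s=\{y\in Y: s(y)=y_0\}$, a zero-dimensional variety over $\mathbb K$ (so $X_u\subset X_{su}$ for all $s,u \in S$). For $s,s'\in S$ with $s'=sr$, $r\in S$, the transition map $\xi_{s,s'}:X_{sr}\to X_s$ is $y\mapsto r(y)$. This is a projective system indexed by $S$ ordered by divisibility; $X=\varprojlim_s X_s$ and $\xi_s:X\to X_s$ are the canonical maps. The base point $y_0$ defines a component $Z_s$ of $X_s$ for each $s$; the inverse images $\xi_{s,s'}^{-1}(Z_s)\subset X_{s'}$ define an open and closed subset $X^{e_s}=\{x\in X:\xi_s(x)\in Z_s\}$ of $X$ ($e_s$ denotes the corresponding projection). *)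

theory Defs
  imports
    "HOL-Analysis.Function_Topology"
    "HOL-Library.Countable_Set"
    "HOL-Algebra.Generated_Rings"
    "HOL-Algebra.Ideal"
    "HOL-Algebra.Module"
begin

text \<open>
  Schemes over a field \<open>K\<close> are treated through their functors of points, following Demazure and
  Gabriel: a \<open>K\<close>-scheme is a functor from commutative \<open>K\<close>-algebras to sets that is a sheaf for the
  Zariski topology and is covered by open affine subfunctors. The (small) category of \<open>K\<close>-algebras
  consists of all \<open>K\<close>-algebras whose carrier is a set of elements of the type \<open>'a\<close> in which \<open>K\<close>
  itself lives; when \<open>'a\<close> is infinite it contains, up to isomorphism, every \<open>K\<close>-algebra with a
  generating set of cardinality at most that of \<open>'a\<close>, hence all coordinate rings that occur for
  schemes of finite type and for countable projective limits of affine ones.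
\<close>

section \<open>Algebras over a field\<close>

type_synonym 'a kalg = "('a, 'a) module"

definition kalgs :: "'a ring \<Rightarrow> 'a kalg set" where
  "kalgs K = {A. Module.algebra K A}"

definition base_alg :: "'a ring \<Rightarrow> 'a kalg" where
  "base_alg K = \<lparr>carrier = carrier K, mult = mult K, one = one K, zero = zero K, add = add K,
     smult = mult K\<rparr>"

text \<open>Homomorphisms are extensional, so that equality in HOL is equality of homomorphisms;
  \<open>ring_hom\<close> includes preservation of the unit.\<close>

definition kalg_hom :: "'a ring \<Rightarrow> 'a kalg \<Rightarrow> 'a kalg \<Rightarrow> ('a \<Rightarrow> 'a) set" where
  "kalg_hom K A B = {h \<in> ring_hom A B. h \<in> extensional (carrier A) \<and>
     (\<forall>k\<in>carrier K. \<forall>a\<in>carrier A. h (k \<odot>\<^bsub>A\<^esub> a) = k \<odot>\<^bsub>B\<^esub> h a)}"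

definition kalg_id :: "'a kalg \<Rightarrow> 'a \<Rightarrow> 'a" where
  "kalg_id A = (\<lambda>a\<in>carrier A. a)"

definition unit_hom :: "'a ring \<Rightarrow> 'a kalg \<Rightarrow> 'a \<Rightarrow> 'a" where
  "unit_hom K A = (\<lambda>k\<in>carrier K. k \<odot>\<^bsub>A\<^esub> \<one>\<^bsub>A\<^esub>)"

definition fin_gen_kalg :: "'a ring \<Rightarrow> 'a kalg \<Rightarrow> bool" where
  "fin_gen_kalg K B \<longleftrightarrow> (\<exists>G. finite G \<and> G \<subseteq> carrier B \<and>
     generate_ring B (unit_hom K B ` carrier K \<union> G) = carrier B)"

definition reduced_kalg :: "'a kalg \<Rightarrow> bool" where
  "reduced_kalg B \<longleftrightarrow>
     (\<forall>b\<in>carrier B. \<forall>n::nat. b [^]\<^bsub>B\<^esub> n = \<zero>\<^bsub>B\<^esub> \<longrightarrow> b = \<zero>\<^bsub>B\<^esub>)"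

definition module_finite :: "'a kalg \<Rightarrow> 'a kalg \<Rightarrow> ('a \<Rightarrow> 'a) \<Rightarrow> bool" where
  "module_finite A B l \<longleftrightarrow> (\<exists>G. finite G \<and> G \<subseteq> carrier B \<and>
     (\<forall>b\<in>carrier B. \<exists>c\<in>G \<rightarrow> carrier A. b = (\<Oplus>\<^bsub>B\<^esub>g\<in>G. l (c g) \<otimes>\<^bsub>B\<^esub> g)))"

definition localization_at :: "'a ring \<Rightarrow> 'a kalg \<Rightarrow> 'a \<Rightarrow> 'a kalg \<Rightarrow> ('a \<Rightarrow> 'a) \<Rightarrow> bool" where
  "localization_at K A f B l \<longleftrightarrow> B \<in> kalgs K \<and> l \<in> kalg_hom K A B \<and> l f \<in> Units B \<and>
     (\<forall>b\<in>carrier B. \<exists>a\<in>carrier A. \<exists>n::nat. b \<otimes>\<^bsub>B\<^esub> (l f [^]\<^bsub>B\<^esub> n) = l a) \<and>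
     (\<forall>a\<in>carrier A. l a = \<zero>\<^bsub>B\<^esub> \<longleftrightarrow> (\<exists>n::nat. (f [^]\<^bsub>A\<^esub> n) \<otimes>\<^bsub>A\<^esub> a = \<zero>\<^bsub>A\<^esub>))"

section \<open>Functors on algebras and their morphisms\<close>

record ('a, 'p) kfunctor =
  pts :: "'a kalg \<Rightarrow> 'p set"
  arr :: "'a kalg \<Rightarrow> 'a kalg \<Rightarrow> ('a \<Rightarrow> 'a) \<Rightarrow> 'p \<Rightarrow> 'p"

definition is_kfunctor :: "'a ring \<Rightarrow> ('a, 'p) kfunctor \<Rightarrow> bool" where
  "is_kfunctor K F \<longleftrightarrow>
     (\<forall>A. A \<notin> kalgs K \<longrightarrow> pts F A = {}) \<and>
     (\<forall>A\<in>kalgs K. \<forall>B\<in>kalgs K. \<forall>h\<in>kalg_hom K A B. arr F A B h \<in> pts F A \<rightarrow> pts F B) \<and>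
     (\<forall>A\<in>kalgs K. \<forall>x\<in>pts F A. arr F A A (kalg_id A) x = x) \<and>
     (\<forall>A\<in>kalgs K. \<forall>B\<in>kalgs K. \<forall>C\<in>kalgs K. \<forall>g\<in>kalg_hom K A B. \<forall>h\<in>kalg_hom K B C. \<forall>x\<in>pts F A.
        arr F A C (compose (carrier A) h g) x = arr F B C h (arr F A B g x))"

text \<open>The functions \<open>\<eta> A\<close> are extensional; as functors have no points over records that are not
  \<open>K\<close>-algebras, equality of morphisms is equality in HOL.\<close>

definition mor :: "'a ring \<Rightarrow> ('a, 'p) kfunctor \<Rightarrow> ('a, 'q) kfunctor \<Rightarrow> ('a kalg \<Rightarrow> 'p \<Rightarrow> 'q) set" where
  "mor K F G = {\<eta>. (\<forall>A. \<eta> A \<in> pts F A \<rightarrow>\<^sub>E pts G A) \<and>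
     (\<forall>A\<in>kalgs K. \<forall>B\<in>kalgs K. \<forall>h\<in>kalg_hom K A B. \<forall>x\<in>pts F A.
        \<eta> B (arr F A B h x) = arr G A B h (\<eta> A x))}"

definition mor_id :: "('a, 'p) kfunctor \<Rightarrow> 'a kalg \<Rightarrow> 'p \<Rightarrow> 'p" where
  "mor_id F = (\<lambda>A. \<lambda>x\<in>pts F A. x)"

definition mor_comp ::
  "('a, 'p) kfunctor \<Rightarrow> ('a kalg \<Rightarrow> 'q \<Rightarrow> 'r) \<Rightarrow> ('a kalg \<Rightarrow> 'p \<Rightarrow> 'q) \<Rightarrow> 'a kalg \<Rightarrow> 'p \<Rightarrow> 'r" where
  "mor_comp F \<theta> \<eta> = (\<lambda>A. compose (pts F A) (\<theta> A) (\<eta> A))"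

definition mor_iso ::
  "'a ring \<Rightarrow> ('a, 'p) kfunctor \<Rightarrow> ('a, 'q) kfunctor \<Rightarrow> ('a kalg \<Rightarrow> 'p \<Rightarrow> 'q) \<Rightarrow> bool" where
  "mor_iso K F G \<eta> \<longleftrightarrow> \<eta> \<in> mor K F G \<and>
     (\<exists>\<theta>\<in>mor K G F. mor_comp F \<theta> \<eta> = mor_id F \<and> mor_comp G \<eta> \<theta> = mor_id G)"

section \<open>Schemes and varieties\<close>

definition Spec :: "'a ring \<Rightarrow> 'a kalg \<Rightarrow> ('a, 'a \<Rightarrow> 'a) kfunctor" where
  "Spec K B = \<lparr>pts = (\<lambda>A. if A \<in> kalgs K then kalg_hom K B A else {}),
     arr = (\<lambda>A A' h \<phi>. compose (carrier B) h \<phi>)\<rparr>"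

definition subfunctor :: "'a ring \<Rightarrow> ('a, 'p) kfunctor \<Rightarrow> ('a kalg \<Rightarrow> 'p set) \<Rightarrow> bool" where
  "subfunctor K F U \<longleftrightarrow> (\<forall>A. U A \<subseteq> pts F A) \<and>
     (\<forall>A\<in>kalgs K. \<forall>B\<in>kalgs K. \<forall>h\<in>kalg_hom K A B. arr F A B h \<in> U A \<rightarrow> U B)"

definition restr :: "('a, 'p) kfunctor \<Rightarrow> ('a kalg \<Rightarrow> 'p set) \<Rightarrow> ('a, 'p) kfunctor" where
  "restr F U = F\<lparr>pts := U\<rparr>"

text \<open>\<open>U\<close> is open in \<open>F\<close> if its pull-back along every \<open>x \<in> F(A)\<close>, i.e. every \<open>x : Spec A \<rightarrow> F\<close>, is the
  open subscheme of \<open>Spec A\<close> complementary to \<open>V(I)\<close> for some ideal \<open>I\<close>.\<close>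

definition open_subfunctor :: "'a ring \<Rightarrow> ('a, 'p) kfunctor \<Rightarrow> ('a kalg \<Rightarrow> 'p set) \<Rightarrow> bool" where
  "open_subfunctor K F U \<longleftrightarrow> subfunctor K F U \<and>
     (\<forall>A\<in>kalgs K. \<forall>x\<in>pts F A. \<exists>I. ideal I A \<and>
        (\<forall>B\<in>kalgs K. \<forall>h\<in>kalg_hom K A B.
           arr F A B h x \<in> U B \<longleftrightarrow> genideal B (h ` I) = carrier B))"

definition affine_open ::
  "'a ring \<Rightarrow> ('a, 'p) kfunctor \<Rightarrow> ('a kalg \<Rightarrow> 'p set) \<Rightarrow> 'a kalg \<Rightarrow> bool" where
  "affine_open K F U B \<longleftrightarrow> B \<in> kalgs K \<and> open_subfunctor K F U \<and>
     (\<exists>\<eta>. mor_iso K (Spec K B) (restr F U) \<eta>)"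

text \<open>The sheaf condition for the coverings of \<open>Spec A\<close> by basic open sets \<open>D(f i)\<close>. Agreement on
  overlaps is required on all algebras \<open>C\<close> over which two members of the covering agree; the
  localization of \<open>A\<close> at \<open>f i \<otimes> f j\<close> is the universal one among them.\<close>

definition zariski_sheaf :: "'a ring \<Rightarrow> ('a, 'p) kfunctor \<Rightarrow> bool" where
  "zariski_sheaf K F \<longleftrightarrow>
     (\<forall>A\<in>kalgs K. \<forall>(n::nat) f B l x.
        (\<forall>i<n. f i \<in> carrier A \<and> localization_at K A (f i) (B i) (l i) \<and> x i \<in> pts F (B i)) \<and>
        genideal A (f ` {..<n}) = carrier A \<and>
        (\<forall>i<n. \<forall>j<n. \<forall>C\<in>kalgs K. \<forall>g\<in>kalg_hom K (B i) C. \<forall>h\<in>kalg_hom K (B j) C.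
           compose (carrier A) g (l i) = compose (carrier A) h (l j) \<longrightarrow>
           arr F (B i) C g (x i) = arr F (B j) C h (x j)) \<longrightarrow>
        (\<exists>!y. y \<in> pts F A \<and> (\<forall>i<n. arr F A (B i) (l i) y = x i)))"

definition open_cover :: "'a ring \<Rightarrow> ('a, 'p) kfunctor \<Rightarrow> ('a kalg \<Rightarrow> 'p set) set \<Rightarrow> bool" where
  "open_cover K F \<U> \<longleftrightarrow> (\<forall>U\<in>\<U>. open_subfunctor K F U) \<and>
     (\<forall>L\<in>kalgs K. field L \<longrightarrow> pts F L = (\<Union>U\<in>\<U>. U L))"

definition scheme :: "'a ring \<Rightarrow> ('a, 'p) kfunctor \<Rightarrow> bool" where
  "scheme K F \<longleftrightarrow> is_kfunctor K F \<and> zariski_sheaf K F \<and>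
     (\<exists>\<U>. open_cover K F \<U> \<and> (\<forall>U\<in>\<U>. \<exists>B. affine_open K F U B))"

definition finite_type :: "'a ring \<Rightarrow> ('a, 'p) kfunctor \<Rightarrow> bool" where
  "finite_type K F \<longleftrightarrow>
     (\<exists>\<U>. finite \<U> \<and> open_cover K F \<U> \<and> (\<forall>U\<in>\<U>. \<exists>B. affine_open K F U B \<and> fin_gen_kalg K B))"

definition reduced :: "'a ring \<Rightarrow> ('a, 'p) kfunctor \<Rightarrow> bool" where
  "reduced K F \<longleftrightarrow> (\<forall>U B. affine_open K F U B \<longrightarrow> reduced_kalg B)"

text \<open>The diagonal \<open>F \<rightarrow> F \<times> F\<close> is a closed immersion.\<close>

definition separated :: "'a ring \<Rightarrow> ('a, 'p) kfunctor \<Rightarrow> bool" where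
  "separated K F \<longleftrightarrow>
     (\<forall>A\<in>kalgs K. \<forall>x\<in>pts F A. \<forall>y\<in>pts F A. \<exists>I. ideal I A \<and>
        (\<forall>B\<in>kalgs K. \<forall>h\<in>kalg_hom K A B.
           arr F A B h x = arr F A B h y \<longleftrightarrow> h ` I \<subseteq> {\<zero>\<^bsub>B\<^esub>}))"

definition variety :: "'a ring \<Rightarrow> ('a, 'p) kfunctor \<Rightarrow> bool" where
  "variety K F \<longleftrightarrow> scheme K F \<and> finite_type K F \<and> reduced K F \<and> separated K F"

section \<open>The underlying topological space\<close>

text \<open>The points of the space \<open>|F|\<close> are the elements of the colimit of \<open>F(L)\<close> over all fields \<open>L\<close>; its
  open sets are the sets \<open>|U|\<close> for \<open>U\<close> an open subfunctor. For a scheme these sets already form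
  a topology, and \<open>|F|\<close> is the usual underlying space.\<close>

definition point_step :: "'a ring \<Rightarrow> ('a, 'p) kfunctor \<Rightarrow> (('a kalg \<times> 'p) \<times> ('a kalg \<times> 'p)) set" where
  "point_step K F = {((L, x), (M, arr F L M h x)) | L M h x.
     L \<in> kalgs K \<and> field L \<and> M \<in> kalgs K \<and> field M \<and> h \<in> kalg_hom K L M \<and> x \<in> pts F L}"

definition point_of :: "'a ring \<Rightarrow> ('a, 'p) kfunctor \<Rightarrow> 'a kalg \<Rightarrow> 'p \<Rightarrow> ('a kalg \<times> 'p) set" where
  "point_of K F L x = (point_step K F \<union> (point_step K F)\<inverse>)\<^sup>* `` {(L, x)}"

definition points :: "'a ring \<Rightarrow> ('a, 'p) kfunctor \<Rightarrow> ('a kalg \<Rightarrow> 'p set) \<Rightarrow> ('a kalg \<times> 'p) set set" where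
  "points K F U = {point_of K F L x | L x. L \<in> kalgs K \<and> field L \<and> x \<in> U L}"

definition space_of :: "'a ring \<Rightarrow> ('a, 'p) kfunctor \<Rightarrow> ('a kalg \<times> 'p) set topology" where
  "space_of K F = topology_generated_by {points K F U | U. open_subfunctor K F U}"

text \<open>For \<open>T\<close> open in \<open>|F|\<close> this is the open subscheme with underlying space \<open>T\<close>.\<close>

definition sub_on :: "'a ring \<Rightarrow> ('a, 'p) kfunctor \<Rightarrow> ('a kalg \<times> 'p) set set \<Rightarrow> 'a kalg \<Rightarrow> 'p set" where
  "sub_on K F T A = {x \<in> pts F A. \<forall>L\<in>kalgs K. \<forall>h\<in>kalg_hom K A L. field L \<longrightarrow>
     point_of K F L (arr F A L h x) \<in> T}"

section \<open>Finite and unramified morphisms\<close>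

text \<open>A morphism \<open>s : F \<rightarrow> G\<close> is finite if its base change along every \<open>y : Spec A \<rightarrow> G\<close> is of the form
  \<open>Spec B \<rightarrow> Spec A\<close> with \<open>B\<close> a finite \<open>A\<close>-module. Below, \<open>z\<close> is the projection \<open>Spec B \<rightarrow> F\<close>.\<close>

definition finite_mor ::
  "'a ring \<Rightarrow> ('a, 'p) kfunctor \<Rightarrow> ('a, 'q) kfunctor \<Rightarrow> ('a kalg \<Rightarrow> 'p \<Rightarrow> 'q) \<Rightarrow> bool" where
  "finite_mor K F G s \<longleftrightarrow> s \<in> mor K F G \<and>
     (\<forall>A\<in>kalgs K. \<forall>y\<in>pts G A. \<exists>B\<in>kalgs K. \<exists>l\<in>kalg_hom K A B. \<exists>z\<in>pts F B.
        module_finite A B l \<and> s B z = arr G A B l y \<and>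
        (\<forall>C\<in>kalgs K. \<forall>g\<in>kalg_hom K A C. \<forall>w\<in>pts F C. s C w = arr G A C g y \<longrightarrow>
           (\<exists>!h. h \<in> kalg_hom K B C \<and> compose (carrier A) h l = g \<and> arr F B C h z = w)))"

text \<open>Infinitesimal criterion: two points of \<open>U\<close> over \<open>A\<close> with the same image in \<open>G\<close> that agree modulo
  an ideal of square zero (the kernel of the surjection \<open>q\<close>) are equal.\<close>

definition formally_unramified_on ::
  "'a ring \<Rightarrow> ('a, 'p) kfunctor \<Rightarrow> ('a kalg \<Rightarrow> 'p set) \<Rightarrow> ('a kalg \<Rightarrow> 'p \<Rightarrow> 'q) \<Rightarrow> bool" where
  "formally_unramified_on K F U s \<longleftrightarrow>
     (\<forall>A\<in>kalgs K. \<forall>B\<in>kalgs K. \<forall>q\<in>kalg_hom K A B.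
        q ` carrier A = carrier B \<and>
        (\<forall>a\<in>carrier A. \<forall>b\<in>carrier A. q a = \<zero>\<^bsub>B\<^esub> \<and> q b = \<zero>\<^bsub>B\<^esub> \<longrightarrow> a \<otimes>\<^bsub>A\<^esub> b = \<zero>\<^bsub>A\<^esub>) \<longrightarrow>
        (\<forall>x\<in>U A. \<forall>y\<in>U A. s A x = s A y \<and> arr F A B q x = arr F A B q y \<longrightarrow> x = y))"

definition base_pt :: "'a ring \<Rightarrow> ('a, 'p) kfunctor \<Rightarrow> 'p \<Rightarrow> 'a kalg \<Rightarrow> 'p" where
  "base_pt K F y\<^sub>0 A = arr F (base_alg K) A (unit_hom K A) y\<^sub>0"

text \<open>A morphism of schemes of finite type is unramified at a point if it is formally unramified on an
  open neighbourhood of it; unramified over \<open>y\<^sub>0\<close> means unramified at all points above \<open>y\<^sub>0\<close>.\<close>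

definition unramified_over ::
  "'a ring \<Rightarrow> ('a, 'p) kfunctor \<Rightarrow> ('a, 'q) kfunctor \<Rightarrow> 'q \<Rightarrow> ('a kalg \<Rightarrow> 'p \<Rightarrow> 'q) \<Rightarrow> bool" where
  "unramified_over K F G y\<^sub>0 s \<longleftrightarrow>
     (\<forall>L\<in>kalgs K. \<forall>x\<in>pts F L. field L \<and> s L x = base_pt K G y\<^sub>0 L \<longrightarrow>
        (\<exists>U. open_subfunctor K F U \<and> x \<in> U L \<and> formally_unramified_on K F U s))"

section \<open>The projective system and its limit\<close>

text \<open>\<open>X\<^sub>s = {y \<in> Y. s(y) = y\<^sub>0}\<close>\<close>

definition fibre ::
  "'a ring \<Rightarrow> ('a, 'p) kfunctor \<Rightarrow> 'p \<Rightarrow> ('a kalg \<Rightarrow> 'p \<Rightarrow> 'p) \<Rightarrow> ('a, 'p) kfunctor" where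
  "fibre K Y y\<^sub>0 s = restr Y (\<lambda>A. {y \<in> pts Y A. s A y = base_pt K Y y\<^sub>0 A})"

text \<open>\<open>\<xi>\<^sub>s\<^sub>,\<^sub>s\<^sub>r : X\<^sub>s\<^sub>r \<rightarrow> X\<^sub>s\<close>, given by \<open>r\<close>\<close>

definition transition ::
  "'a ring \<Rightarrow> ('a, 'p) kfunctor \<Rightarrow> 'p \<Rightarrow> ('a kalg \<Rightarrow> 'p \<Rightarrow> 'p) \<Rightarrow> ('a kalg \<Rightarrow> 'p \<Rightarrow> 'p) \<Rightarrow>
   'a kalg \<Rightarrow> 'p \<Rightarrow> 'p" where
  "transition K Y y\<^sub>0 s r = (\<lambda>A. \<lambda>y\<in>pts (fibre K Y y\<^sub>0 (mor_comp Y s r)) A. r A y)"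

text \<open>The limit \<open>X\<close>; limits of functors of points are computed pointwise. Compatibility is imposed for
  every factorization \<open>s' = s r\<close> with \<open>r \<in> S\<close>.\<close>

definition tower_limit ::
  "'a ring \<Rightarrow> ('a, 'p) kfunctor \<Rightarrow> 'p \<Rightarrow> ('a kalg \<Rightarrow> 'p \<Rightarrow> 'p) set \<Rightarrow>
   ('a, ('a kalg \<Rightarrow> 'p \<Rightarrow> 'p) \<Rightarrow> 'p) kfunctor" where
  "tower_limit K Y y\<^sub>0 S =
     \<lparr>pts = (\<lambda>A. if A \<in> kalgs K
        then {x \<in> (\<Pi>\<^sub>E s\<in>S. pts (fibre K Y y\<^sub>0 s) A).
               \<forall>s\<in>S. \<forall>r\<in>S. transition K Y y\<^sub>0 s r A (x (mor_comp Y s r)) = x s}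
        else {}),
      arr = (\<lambda>A B h x. \<lambda>s\<in>S. arr Y A B h (x s))\<rparr>"

definition proj ::
  "'a ring \<Rightarrow> ('a, 'p) kfunctor \<Rightarrow> 'p \<Rightarrow> ('a kalg \<Rightarrow> 'p \<Rightarrow> 'p) set \<Rightarrow> ('a kalg \<Rightarrow> 'p \<Rightarrow> 'p) \<Rightarrow>
   'a kalg \<Rightarrow> (('a kalg \<Rightarrow> 'p \<Rightarrow> 'p) \<Rightarrow> 'p) \<Rightarrow> 'p" where
  "proj K Y y\<^sub>0 S s = (\<lambda>A. \<lambda>x\<in>pts (tower_limit K Y y\<^sub>0 S) A. x s)"

text \<open>\<open>Z\<^sub>s\<close>, the connected component of the base point in \<open>X\<^sub>s\<close>, as an open subscheme of \<open>X\<^sub>s\<close>\<close>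

definition base_component ::
  "'a ring \<Rightarrow> ('a, 'p) kfunctor \<Rightarrow> 'p \<Rightarrow> ('a kalg \<Rightarrow> 'p \<Rightarrow> 'p) \<Rightarrow> 'a kalg \<Rightarrow> 'p set" where
  "base_component K Y y\<^sub>0 s = sub_on K (fibre K Y y\<^sub>0 s)
     (connected_component_of_set (space_of K (fibre K Y y\<^sub>0 s))
        (point_of K (fibre K Y y\<^sub>0 s) (base_alg K) y\<^sub>0))"

text \<open>\<open>X\<^sup>e = {x \<in> X. \<xi>\<^sub>s(x) \<in> Z\<^sub>s}\<close>, for \<open>e = e\<^sub>s\<close>\<close>

definition limit_part ::
  "'a ring \<Rightarrow> ('a, 'p) kfunctor \<Rightarrow> 'p \<Rightarrow> ('a kalg \<Rightarrow> 'p \<Rightarrow> 'p) set \<Rightarrow> ('a kalg \<Rightarrow> 'p \<Rightarrow> 'p) \<Rightarrow>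
   ('a, ('a kalg \<Rightarrow> 'p \<Rightarrow> 'p) \<Rightarrow> 'p) kfunctor" where
  "limit_part K Y y\<^sub>0 S s = restr (tower_limit K Y y\<^sub>0 S)
     (\<lambda>A. {x \<in> pts (tower_limit K Y y\<^sub>0 S) A. proj K Y y\<^sub>0 S s A x \<in> base_component K Y y\<^sub>0 s A})"

text \<open>The unit of the unital semigroup \<open>S\<close> is the identity endomorphism of \<open>Y\<close>.\<close>

definition endo_semigroup ::
  "'a ring \<Rightarrow> ('a, 'p) kfunctor \<Rightarrow> 'p \<Rightarrow> ('a kalg \<Rightarrow> 'p \<Rightarrow> 'p) set \<Rightarrow> bool" where
  "endo_semigroup K Y y\<^sub>0 S \<longleftrightarrow> S \<subseteq> mor K Y Y \<and> (\<forall>s\<in>S. s (base_alg K) y\<^sub>0 = y\<^sub>0) \<and>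
     comm_monoid \<lparr>carrier = S, monoid.mult = mor_comp Y, one = mor_id Y\<rparr>"

definition limit_property ::
  "'a ring \<Rightarrow> ('a, 'p) kfunctor \<Rightarrow> 'p \<Rightarrow> ('a kalg \<Rightarrow> 'p \<Rightarrow> 'p) set \<Rightarrow> ('a kalg \<Rightarrow> 'p \<Rightarrow> 'p) \<Rightarrow>
   ('a kalg \<Rightarrow> (('a kalg \<Rightarrow> 'p \<Rightarrow> 'p) \<Rightarrow> 'p) \<Rightarrow> (('a kalg \<Rightarrow> 'p \<Rightarrow> 'p) \<Rightarrow> 'p)) \<Rightarrow> bool" where
  "limit_property K Y y\<^sub>0 S s \<beta> \<longleftrightarrow>
     (\<forall>u\<in>S. \<forall>A\<in>kalgs K. \<forall>x\<in>pts (tower_limit K Y y\<^sub>0 S) A.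
        proj K Y y\<^sub>0 S (mor_comp Y s u) A (\<beta> A x) = proj K Y y\<^sub>0 S u A x)"

end

theory Submission
  imports Defs "HOL-Algebra.Ideal_Product" "HOL-Algebra.Ring_Divisibility"
begin

text \<open>
  Compatibility in the limit makes the coordinate of \<open>\<beta>\<^sub>s(x)\<close> at \<open>v\<close> the image under \<open>s\<close> of its
  coordinate at \<open>sv\<close>, so the defining property leaves only \<open>\<beta>\<^sub>s(x)\<^sub>v = s(x\<^sub>v)\<close>. As the elements of
  \<open>S\<close> commute and fix \<open>y\<^sub>0\<close>, this formula does define an endomorphism of \<open>X\<close>, and it is visibly
  multiplicative in \<open>s\<close>. Its image is contained in the fibre of \<open>\<xi>\<^sub>s\<close> over \<open>y\<^sub>0\<close>, as
  \<open>\<beta>\<^sub>s(x)\<^sub>s = s(x\<^sub>s) = y\<^sub>0\<close>; conversely, for \<open>z\<close> with \<open>z\<^sub>s = y\<^sub>0\<close> the shifted family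
  \<open>u \<mapsto> z\<^sub>s\<^sub>u\<close> is again a point of \<open>X\<close>, because \<open>u(z\<^sub>s\<^sub>u) = z\<^sub>s = y\<^sub>0\<close>, and shifting inverts \<open>\<beta>\<^sub>s\<close>
  (lemmas \<open>\<beta>_shift\<close>, \<open>shift_\<beta>\<close> and \<open>\<beta>_mor_iso\<close>).

  What remains is that the component \<open>Z\<^sub>s\<close> of the base point in \<open>X\<^sub>s\<close> is the reduced rational point
  \<open>y\<^sub>0\<close>, as a functor of points (lemma \<open>base_component_eq_base_pt\<close>). Finiteness of \<open>s\<close> gives
  \<open>X\<^sub>s = Spec B\<close> with \<open>B\<close> finite over \<open>K\<close>, and \<open>y\<^sub>0\<close> is an augmentation \<open>B \<rightarrow> K\<close> with finitely generated
  kernel \<open>\<mm>\<close>. That \<open>s\<close> is unramified at \<open>y\<^sub>0\<close>, tested on \<open>B/\<mm>\<^sup>2 \<rightarrow> K\<close>, gives \<open>\<mm> = \<mm>\<^sup>2\<close>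
  (lemma \<open>\<mm>_subset_square\<close>), and Nakayama's lemma yields an idempotent \<open>e\<close> that generates \<open>\<mm>\<close> (lemma
  \<open>idempotent_ideal_has_unit\<close>). Thus \<open>y\<^sub>0\<close> is cut out by \<open>e = 0\<close>, an open and closed condition, and the
  component cannot leave it. On points with values in an arbitrary algebra this needs that an
  idempotent that vanishes in all residue fields is zero (lemmas \<open>idempotent_eq_zeroI\<close> and
  \<open>connected_component_kills_idempotent\<close>).
\<close>

section \<open>Algebras over a field\<close>

lemma kalgs_algebra: "A \<in> kalgs K \<Longrightarrow> algebra K A"
  by (simp add: kalgs_def)

lemma kalgs_cring: "A \<in> kalgs K \<Longrightarrow> cring A"
  using kalgs_algebra algebra.M_cring by blast

lemma kalg_hom_ring_hom_cring:
  assumes "A \<in> kalgs K" "B \<in> kalgs K" "h \<in> kalg_hom K A B"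
  shows "ring_hom_cring A B h"
  using assms kalgs_cring
  by (auto simp: ring_hom_cring_def ring_hom_cring_axioms_def kalg_hom_def)

lemma kalg_hom_smult:
  "h \<in> kalg_hom K A B \<Longrightarrow> k \<in> carrier K \<Longrightarrow> a \<in> carrier A \<Longrightarrow> h (k \<odot>\<^bsub>A\<^esub> a) = k \<odot>\<^bsub>B\<^esub> h a"
  by (simp add: kalg_hom_def)

lemma kalg_hom_closed: "h \<in> kalg_hom K A B \<Longrightarrow> a \<in> carrier A \<Longrightarrow> h a \<in> carrier B"
  by (auto simp: kalg_hom_def intro: ring_hom_closed)

lemma kalg_hom_extensional: "h \<in> kalg_hom K A B \<Longrightarrow> h \<in> extensional (carrier A)"
  by (simp add: kalg_hom_def)

lemma kalg_hom_eqI: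
  assumes "g \<in> kalg_hom K A B" "h \<in> kalg_hom K A B'"
    and "\<And>a. a \<in> carrier A \<Longrightarrow> g a = h a"
  shows "g = h"
  using assms by (meson extensionalityI kalg_hom_extensional)

lemma kalg_hom_compose:
  assumes "A \<in> kalgs K" "g \<in> kalg_hom K A B" "h \<in> kalg_hom K B C"
  shows "compose (carrier A) h g \<in> kalg_hom K A C"
proof -
  interpret A: cring A
    using assms(1) by (rule kalgs_cring)
  interpret AA: algebra K A
    using assms(1) by (rule kalgs_algebra)
  have "compose (carrier A) h g \<in> ring_hom A C"
    using assms(2,3) unfolding kalg_hom_def
    by (intro ring_hom_memI)
      (auto simp: compose_def ring_hom_closed ring_hom_mult ring_hom_add ring_hom_one)
  then show ?thesis
    using assms unfolding kalg_hom_def by (auto simp: compose_def ring_hom_closed)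
qed

lemma kalg_id_hom:
  assumes "A \<in> kalgs K"
  shows "kalg_id A \<in> kalg_hom K A A"
proof -
  interpret A: cring A
    using assms(1) by (rule kalgs_cring)
  interpret AA: algebra K A
    using assms(1) by (rule kalgs_algebra)
  show ?thesis
    by (auto simp: kalg_id_def kalg_hom_def intro!: ring_hom_memI)
qed

lemma base_alg_simps [simp]:
  "carrier (base_alg K) = carrier K" "monoid.mult (base_alg K) = monoid.mult K" "one (base_alg K) = one K"
  "zero (base_alg K) = zero K" "add (base_alg K) = add K" "smult (base_alg K) = monoid.mult K"
  by (simp_all add: base_alg_def)

lemma base_alg_cring:
  assumes "cring K"
  shows "cring (base_alg K)"
proof -
  interpret cring K by fact
  have "abelian_group (base_alg K)"
    by (rule abelian_groupI) (use l_neg in \<open>auto simp: a_ac\<close>)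
  then show ?thesis
    by (rule cringI) (auto simp: l_distr m_assoc intro!: comm_monoidI intro: m_comm)
qed

lemma base_alg_kalgs:
  assumes "cring K"
  shows "base_alg K \<in> kalgs K"
proof -
  interpret cring K by fact
  have "algebra K (base_alg K)"
    by (rule algebraI)
      (use base_alg_cring[OF assms] assms in \<open>auto simp: l_distr r_distr m_assoc\<close>)
  then show ?thesis
    by (simp add: kalgs_def)
qed

lemma base_alg_field:
  assumes "field K"
  shows "field (base_alg K)"
proof -
  interpret field K by fact
  interpret B: cring "base_alg K"
    using base_alg_cring is_cring by blast
  have "Units (base_alg K) = Units K"
    by (simp add: Units_def)
  then show ?thesis
    by (intro B.cring_fieldI) (simp add: field_Units)
qed

lemma unit_hom_kalg_hom:
  assumes "A \<in> kalgs K"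
  shows "unit_hom K A \<in> kalg_hom K (base_alg K) A"
proof -
  interpret A: cring A
    using assms by (rule kalgs_cring)
  interpret AA: algebra K A
    using assms by (rule kalgs_algebra)
  have "unit_hom K A \<in> ring_hom (base_alg K) A"
    by (rule ring_hom_memI)
      (auto simp: unit_hom_def AA.smult_l_distr AA.smult_assoc1 AA.smult_assoc2)
  then show ?thesis
    by (auto simp: kalg_hom_def unit_hom_def AA.smult_assoc1)
qed

text \<open>
  The structure map is the only \<open>K\<close>-homomorphism out of \<open>K\<close>, since \<open>1\<close> spans \<open>K\<close>. All
  compatibilities of base points below are instances of this.
\<close>

lemma base_alg_hom_unique:
  assumes "cring K" "h \<in> kalg_hom K (base_alg K) A"
  shows "h = unit_hom K A"
proof (rule extensionalityI[of _ "carrier K"])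
  interpret cring K by fact
  show "h \<in> extensional (carrier K)"
    using kalg_hom_extensional[OF assms(2)] by simp
  fix k assume k: "k \<in> carrier K"
  have "h k = h (k \<odot>\<^bsub>base_alg K\<^esub> \<one>\<^bsub>K\<^esub>)"
    using k by simp
  also have "\<dots> = k \<odot>\<^bsub>A\<^esub> h \<one>\<^bsub>K\<^esub>"
    by (rule kalg_hom_smult[OF assms(2)]) (use k in auto)
  also have "h \<one>\<^bsub>K\<^esub> = \<one>\<^bsub>A\<^esub>"
    using assms(2) by (simp add: kalg_hom_def ring_hom_def)
  finally show "h k = unit_hom K A k"
    using k by (simp add: unit_hom_def)
qed (simp add: unit_hom_def)

section \<open>Quotients\<close>

lemma (in ideal) rcos_eq_iff:
  assumes "x \<in> carrier R" "y \<in> carrier R"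
  shows "I +> x = I +> y \<longleftrightarrow> x \<ominus> y \<in> I"
  using quotient_eq_iff_same_a_r_cos[OF is_ideal assms] by simp

text \<open>
  Cosets are sets of elements, hence not of the type on which algebras live. The quotient is
  therefore carried by one chosen representative per coset, and \<open>r\<close> sends an element to
  the representative of its coset.
\<close>

lemma quotient_kalg_exists:
  assumes A: "A \<in> kalgs K" and I: "ideal I A"
  obtains Q q where "Q \<in> kalgs K" "q \<in> kalg_hom K A Q" "q ` carrier A = carrier Q"
    "\<And>a. a \<in> carrier A \<Longrightarrow> q a = \<zero>\<^bsub>Q\<^esub> \<longleftrightarrow> a \<in> I"
proof -
  interpret A: cring A
    using A by (rule kalgs_cring)
  interpret AA: algebra K A
    using A by (rule kalgs_algebra)
  interpret I: ideal I A
    by (rule I)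
  define r where "r a = (SOME b. b \<in> I +>\<^bsub>A\<^esub> a)" for a
  have r_coset: "r a \<in> I +>\<^bsub>A\<^esub> a" if "a \<in> carrier A" for a
    unfolding r_def using I.a_rcos_self[OF that] by (rule someI)
  have r_carr: "r a \<in> carrier A" if "a \<in> carrier A" for a
    using r_coset[OF that] A.a_r_coset_subset_G[OF I.a_subset that] by blast
  have coset_r: "I +>\<^bsub>A\<^esub> r a = I +>\<^bsub>A\<^esub> a" if "a \<in> carrier A" for a
    using I.a_repr_independence'[OF r_coset[OF that] that] by simp
  have r_eq: "r a = r b \<longleftrightarrow> I +>\<^bsub>A\<^esub> a = I +>\<^bsub>A\<^esub> b" if "a \<in> carrier A" "b \<in> carrier A" for a b
    using coset_r[OF that(1)] coset_r[OF that(2)] by (metis r_def)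
  have r_diff: "r a = r b \<longleftrightarrow> a \<ominus>\<^bsub>A\<^esub> b \<in> I" if "a \<in> carrier A" "b \<in> carrier A" for a b
    using r_eq[OF that] I.rcos_eq_iff[OF that] by simp
  have r_r: "r a \<ominus>\<^bsub>A\<^esub> a \<in> I" if "a \<in> carrier A" for a
    using r_carr[OF that] coset_r[OF that] I.rcos_eq_iff that by simp
  have r_add: "r (r a \<oplus>\<^bsub>A\<^esub> r b) = r (a \<oplus>\<^bsub>A\<^esub> b)" if "a \<in> carrier A" "b \<in> carrier A" for a b
  proof -
    have "r a \<oplus>\<^bsub>A\<^esub> r b \<ominus>\<^bsub>A\<^esub> (a \<oplus>\<^bsub>A\<^esub> b) = (r a \<ominus>\<^bsub>A\<^esub> a) \<oplus>\<^bsub>A\<^esub> (r b \<ominus>\<^bsub>A\<^esub> b)"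
      using r_carr that by algebra
    then show ?thesis
      using that r_carr r_r by (simp add: r_diff)
  qed
  have r_mult: "r (r a \<otimes>\<^bsub>A\<^esub> r b) = r (a \<otimes>\<^bsub>A\<^esub> b)" if "a \<in> carrier A" "b \<in> carrier A" for a b
  proof -
    have "r a \<otimes>\<^bsub>A\<^esub> r b \<ominus>\<^bsub>A\<^esub> (a \<otimes>\<^bsub>A\<^esub> b) = (r a \<ominus>\<^bsub>A\<^esub> a) \<otimes>\<^bsub>A\<^esub> r b \<oplus>\<^bsub>A\<^esub> a \<otimes>\<^bsub>A\<^esub> (r b \<ominus>\<^bsub>A\<^esub> b)"
      using r_carr that by algebra
    then show ?thesis
      using that r_carr r_r by (simp add: r_diff I.I_l_closed I.I_r_closed)
  qed
  have r_smult: "r (k \<odot>\<^bsub>A\<^esub> r a) = r (k \<odot>\<^bsub>A\<^esub> a)" if "k \<in> carrier K" "a \<in> carrier A" for k a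
  proof -
    have eq: "k \<odot>\<^bsub>A\<^esub> c = (k \<odot>\<^bsub>A\<^esub> \<one>\<^bsub>A\<^esub>) \<otimes>\<^bsub>A\<^esub> c" if "c \<in> carrier A" for c
      using that \<open>k \<in> carrier K\<close> AA.smult_assoc2[of k "\<one>\<^bsub>A\<^esub>" c] by simp
    have "k \<odot>\<^bsub>A\<^esub> \<one>\<^bsub>A\<^esub> \<in> carrier A"
      using that by simp
    then have "k \<odot>\<^bsub>A\<^esub> r a \<ominus>\<^bsub>A\<^esub> k \<odot>\<^bsub>A\<^esub> a = (k \<odot>\<^bsub>A\<^esub> \<one>\<^bsub>A\<^esub>) \<otimes>\<^bsub>A\<^esub> (r a \<ominus>\<^bsub>A\<^esub> a)"
      using r_carr[OF that(2)] that unfolding eq[OF r_carr[OF that(2)]] eq[OF that(2)] by algebra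
    then show ?thesis
      using that r_carr r_r by (simp add: r_diff I.I_l_closed)
  qed
  define Q :: "'a kalg" where "Q = \<lparr>carrier = r ` carrier A, monoid.mult = \<lambda>x y. r (x \<otimes>\<^bsub>A\<^esub> y),
    one = r \<one>\<^bsub>A\<^esub>, zero = r \<zero>\<^bsub>A\<^esub>, add = \<lambda>x y. r (x \<oplus>\<^bsub>A\<^esub> y), smult = \<lambda>k x. r (k \<odot>\<^bsub>A\<^esub> x)\<rparr>"
  have Q_simps: "carrier Q = r ` carrier A" "monoid.mult Q = (\<lambda>x y. r (x \<otimes>\<^bsub>A\<^esub> y))"
    "one Q = r \<one>\<^bsub>A\<^esub>" "zero Q = r \<zero>\<^bsub>A\<^esub>" "add Q = (\<lambda>x y. r (x \<oplus>\<^bsub>A\<^esub> y))"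
    "smult Q = (\<lambda>k x. r (k \<odot>\<^bsub>A\<^esub> x))"
    by (simp_all add: Q_def)
  have r_hom: "r \<in> ring_hom A Q"
    by (rule ring_hom_memI) (auto simp: Q_simps r_add r_mult)
  \<comment> \<open>\<open>r\<close> is onto and respects the operations, so the ring axioms pass from \<open>A\<close> to \<open>Q\<close>.\<close>
  have "ring (Q\<lparr>carrier := r ` carrier A, zero := r \<zero>\<^bsub>A\<^esub>\<rparr>)"
    using r_hom by (rule A.ring_hom_imp_img_ring)
  then have "ring Q"
    by (simp add: Q_def)
  then interpret Q: ring Q .
  have Q_cring: "cring Q"
    by unfold_locales (auto simp: Q_simps r_mult A.m_comm)
  have "algebra K Q"
    by (rule algebraI)
      (use Q_cring AA.R_cring in \<open>auto simp: Q_simps r_add r_mult r_smult AA.smult_l_distr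
        AA.smult_r_distr AA.smult_assoc1 AA.smult_assoc2\<close>)
  then have Q: "Q \<in> kalgs K"
    by (simp add: kalgs_def)
  define q where "q = restrict r (carrier A)"
  have "q \<in> kalg_hom K A Q"
    unfolding kalg_hom_def
    by (auto simp: q_def Q_simps r_add r_mult r_smult intro!: ring_hom_memI)
  moreover have "q ` carrier A = carrier Q"
    by (simp add: q_def Q_simps)
  moreover have "q a = \<zero>\<^bsub>Q\<^esub> \<longleftrightarrow> a \<in> I" if "a \<in> carrier A" for a
    using that by (simp add: q_def Q_simps r_diff A.minus_eq)
  ultimately show ?thesis
    using that Q by blast
qed

lemma kalg_hom_factor:
  assumes A: "A \<in> kalgs K" and Q: "Q \<in> kalgs K" and C: "C \<in> kalgs K"
    and q: "q \<in> kalg_hom K A Q" and surj: "q ` carrier A = carrier Q"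
    and f: "f \<in> kalg_hom K A C"
    and ker: "\<And>a. a \<in> carrier A \<Longrightarrow> q a = \<zero>\<^bsub>Q\<^esub> \<Longrightarrow> f a = \<zero>\<^bsub>C\<^esub>"
  obtains g where "g \<in> kalg_hom K Q C" "\<And>a. a \<in> carrier A \<Longrightarrow> g (q a) = f a"
proof -
  interpret A: cring A
    using A by (rule kalgs_cring)
  interpret AA: algebra K A
    using A by (rule kalgs_algebra)
  interpret Q: cring Q
    using Q by (rule kalgs_cring)
  interpret C: cring C
    using C by (rule kalgs_cring)
  interpret q: ring_hom_cring A Q q
    using A Q q by (rule kalg_hom_ring_hom_cring)
  interpret f: ring_hom_cring A C f
    using A C f by (rule kalg_hom_ring_hom_cring)
  have eq: "f a = f b" if "a \<in> carrier A" "b \<in> carrier A" "q a = q b" for a b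
  proof -
    have "q (a \<ominus>\<^bsub>A\<^esub> b) = \<zero>\<^bsub>Q\<^esub>"
      using that by (simp add: A.minus_eq Q.r_neg)
    then have "f (a \<ominus>\<^bsub>A\<^esub> b) = \<zero>\<^bsub>C\<^esub>"
      using that ker by simp
    then have "f a \<ominus>\<^bsub>C\<^esub> f b = \<zero>\<^bsub>C\<^esub>"
      using that by (simp add: A.minus_eq C.minus_eq)
    then show ?thesis
      using that by simp
  qed
  define g where "g = (\<lambda>y\<in>carrier Q. f (inv_into (carrier A) q y))"
  have gq: "g (q a) = f a" if "a \<in> carrier A" for a
    using that eq[of "inv_into (carrier A) q (q a)" a]
    by (simp add: g_def inv_into_into f_inv_into_f)
  have lift: "\<exists>a\<in>carrier A. y = q a" if "y \<in> carrier Q" for y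
    using that surj by blast
  have "g \<in> ring_hom Q C"
  proof (rule ring_hom_memI)
    show "g \<one>\<^bsub>Q\<^esub> = \<one>\<^bsub>C\<^esub>"
      using gq[of "\<one>\<^bsub>A\<^esub>"] by simp
    fix x y assume xy: "x \<in> carrier Q" "y \<in> carrier Q"
    obtain a where a: "a \<in> carrier A" "x = q a"
      using lift[OF xy(1)] by blast
    obtain b where b: "b \<in> carrier A" "y = q b"
      using lift[OF xy(2)] by blast
    note ab = a b
    show "g x \<in> carrier C"
      using ab gq by simp
    show "g (x \<otimes>\<^bsub>Q\<^esub> y) = g x \<otimes>\<^bsub>C\<^esub> g y"
      using ab gq gq[of "a \<otimes>\<^bsub>A\<^esub> b"] by simp
    show "g (x \<oplus>\<^bsub>Q\<^esub> y) = g x \<oplus>\<^bsub>C\<^esub> g y"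
      using ab gq gq[of "a \<oplus>\<^bsub>A\<^esub> b"] by simp
  qed
  moreover have "g (k \<odot>\<^bsub>Q\<^esub> x) = k \<odot>\<^bsub>C\<^esub> g x" if k: "k \<in> carrier K" and x: "x \<in> carrier Q" for k x
  proof -
    obtain a where a: "a \<in> carrier A" "x = q a"
      using lift[OF x] by blast
    show ?thesis
      using a k gq[of "k \<odot>\<^bsub>A\<^esub> a"] gq[of a] by (simp add: kalg_hom_smult[OF q] kalg_hom_smult[OF f])
  qed
  ultimately have "g \<in> kalg_hom K Q C"
    by (simp add: kalg_hom_def g_def)
  then show ?thesis
    using gq that by blast
qed

section \<open>Residue fields, idempotents and Nakayama's lemma\<close>

lemma (in cring) exists_maximal_ideal:
  assumes "ideal I R" "I \<noteq> carrier R"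
  obtains M where "maximalideal M R" "I \<subseteq> M"
proof -
  define \<A> where "\<A> = {J. ideal J R \<and> I \<subseteq> J \<and> \<one> \<notin> J}"
  have "\<exists>M\<in>\<A>. \<forall>J\<in>\<A>. M \<subseteq> J \<longrightarrow> J = M"
  proof (rule subset_Zorn_nonempty)
    show "\<A> \<noteq> {}"
      using assms ideal.one_imp_carrier unfolding \<A>_def by blast
    fix \<C> assume \<C>: "\<C> \<noteq> {}" "subset.chain \<A> \<C>"
    then have "subset.chain {J. ideal J R} \<C>"
      by (auto simp: pred_on.chain_def \<A>_def)
    then have "ideal (\<Union>\<C>) R"
      using chain_Union_is_ideal[of \<C>] \<C>(1) by simp
    then show "\<Union>\<C> \<in> \<A>"
      using \<C> unfolding \<A>_def pred_on.chain_def by blast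
  qed
  then obtain M where M: "M \<in> \<A>" "\<And>J. J \<in> \<A> \<Longrightarrow> M \<subseteq> J \<Longrightarrow> J = M"
    by blast
  have "maximalideal M R"
  proof (rule maximalidealI)
    show "ideal M R" "carrier R \<noteq> M"
      using M(1) by (auto simp: \<A>_def)
    fix J assume J: "ideal J R" "M \<subseteq> J" "J \<subseteq> carrier R"
    then show "J = M \<or> J = carrier R"
      using M ideal.one_imp_carrier[OF J(1)] unfolding \<A>_def by blast
  qed
  then show ?thesis
    using that M(1) by (auto simp: \<A>_def)
qed

lemma residue_field_exists:
  assumes A: "A \<in> kalgs K" and "ideal I A" "I \<noteq> carrier A"
  obtains L h where "L \<in> kalgs K" "field L" "h \<in> kalg_hom K A L"
    "\<And>a. a \<in> I \<Longrightarrow> h a = \<zero>\<^bsub>L\<^esub>"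
proof -
  interpret A: cring A
    using A by (rule kalgs_cring)
  obtain M where M: "maximalideal M A" "I \<subseteq> M"
    using A.exists_maximal_ideal assms(2,3) by blast
  interpret M: maximalideal M A
    by (rule M)
  obtain L h where L: "L \<in> kalgs K" and h: "h \<in> kalg_hom K A L"
    and surj: "h ` carrier A = carrier L"
    and ker: "\<And>a. a \<in> carrier A \<Longrightarrow> h a = \<zero>\<^bsub>L\<^esub> \<longleftrightarrow> a \<in> M"
    using quotient_kalg_exists[OF A M.is_ideal] by blast
  interpret L: cring L
    using L by (rule kalgs_cring)
  interpret h: ring_hom_cring A L h
    using A L h by (rule kalg_hom_ring_hom_cring)
  have "field L"
  proof (rule L.cring_fieldI2)
    show "\<zero>\<^bsub>L\<^esub> \<noteq> \<one>\<^bsub>L\<^esub>"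
      using ker[of "\<one>\<^bsub>A\<^esub>"] M.I_notcarr M.one_imp_carrier by auto
    fix x assume x: "x \<in> carrier L" "x \<noteq> \<zero>\<^bsub>L\<^esub>"
    then obtain a where a: "a \<in> carrier A" "x = h a"
      using surj by blast
    then have "a \<notin> M"
      using ker x(2) by blast
    define J where "J = M <+>\<^bsub>A\<^esub> PIdl\<^bsub>A\<^esub> a"
    have J: "ideal J A"
      unfolding J_def using A.add_ideals M.is_ideal A.cgenideal_ideal a(1) by blast
    have "M \<subseteq> J"
    proof
      fix m assume "m \<in> M"
      moreover have "\<zero>\<^bsub>A\<^esub> \<in> PIdl\<^bsub>A\<^esub> a"
        using A.cgenideal_ideal[OF a(1)] additive_subgroup.zero_closed ideal.axioms(1) by blast
      ultimately show "m \<in> J"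
        unfolding J_def set_add_def' using M.Icarr by force
    qed
    moreover have "a \<in> J"
    proof -
      have "\<zero>\<^bsub>A\<^esub> \<oplus>\<^bsub>A\<^esub> a \<in> J"
        unfolding J_def set_add_def' using A.cgenideal_self[OF a(1)] M.zero_closed by blast
      then show ?thesis
        using a(1) by simp
    qed
    moreover have "J \<subseteq> carrier A"
      using J by (meson ideal.Icarr subsetI)
    ultimately have "J = carrier A"
      using M.I_maximal[OF J] \<open>a \<notin> M\<close> by blast
    then have "\<one>\<^bsub>A\<^esub> \<in> J"
      by simp
    then obtain m c where mc: "m \<in> M" "c \<in> carrier A" "\<one>\<^bsub>A\<^esub> = m \<oplus>\<^bsub>A\<^esub> c \<otimes>\<^bsub>A\<^esub> a"
      unfolding J_def set_add_def' cgenideal_def by blast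
    have "h \<one>\<^bsub>A\<^esub> = h m \<oplus>\<^bsub>L\<^esub> h c \<otimes>\<^bsub>L\<^esub> h a"
      unfolding mc(3) using mc a M.Icarr by simp
    then have "x \<otimes>\<^bsub>L\<^esub> h c = \<one>\<^bsub>L\<^esub>"
      using mc(1,2) a ker[of m] M.Icarr[OF mc(1)] h.hom_one by (simp add: L.m_comm)
    then show "\<exists>b\<in>carrier L. x \<otimes>\<^bsub>L\<^esub> b = \<one>\<^bsub>L\<^esub>"
      using mc(2) by auto
  qed
  then show ?thesis
    using that L h ker M(2) M.Icarr by blast
qed

text \<open>
  The spectrum sees idempotents exactly: if \<open>1 - e\<close> were not a unit, it would vanish in some
  residue field, in which \<open>e\<close> would then be \<open>1\<close>; and as a unit killed by \<open>e\<close> it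
  forces \<open>e = 0\<close>. This is what lets a condition on field-valued points control points with
  values in rings that may have nilpotents.
\<close>

lemma idempotent_eq_zeroI:
  assumes A: "A \<in> kalgs K" and e: "e \<in> carrier A" "e \<otimes>\<^bsub>A\<^esub> e = e"
    and vanish: "\<And>L h. L \<in> kalgs K \<Longrightarrow> field L \<Longrightarrow> h \<in> kalg_hom K A L \<Longrightarrow> h e = \<zero>\<^bsub>L\<^esub>"
  shows "e = \<zero>\<^bsub>A\<^esub>"
proof -
  interpret A: cring A
    using A by (rule kalgs_cring)
  define f where "f = \<one>\<^bsub>A\<^esub> \<ominus>\<^bsub>A\<^esub> e"
  have f: "f \<in> carrier A"
    using e(1) by (simp add: f_def)
  have "PIdl\<^bsub>A\<^esub> f = carrier A"
  proof (rule ccontr)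
    assume "PIdl\<^bsub>A\<^esub> f \<noteq> carrier A"
    then obtain L h where L: "L \<in> kalgs K" "field L" and h: "h \<in> kalg_hom K A L"
      and ker: "\<And>a. a \<in> PIdl\<^bsub>A\<^esub> f \<Longrightarrow> h a = \<zero>\<^bsub>L\<^esub>"
      using residue_field_exists[OF A A.cgenideal_ideal[OF f]] by blast
    interpret L: field L
      by (rule L(2))
    interpret h: ring_hom_cring A L h
      using A L(1) h by (rule kalg_hom_ring_hom_cring)
    have "h f = \<zero>\<^bsub>L\<^esub>"
      using ker A.cgenideal_self[OF f] by blast
    then show False
      using e(1) vanish[OF L h] by (simp add: f_def A.minus_eq)
  qed
  then have "\<one>\<^bsub>A\<^esub> \<in> PIdl\<^bsub>A\<^esub> f"
    by simp
  then obtain c where c: "c \<in> carrier A" "\<one>\<^bsub>A\<^esub> = c \<otimes>\<^bsub>A\<^esub> f"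
    by (auto simp: cgenideal_def)
  have "f \<otimes>\<^bsub>A\<^esub> e = \<zero>\<^bsub>A\<^esub>"
    using e by (simp add: f_def A.minus_eq A.l_distr A.l_minus A.r_neg)
  moreover have "e = c \<otimes>\<^bsub>A\<^esub> (f \<otimes>\<^bsub>A\<^esub> e)"
    using c e(1) f A.m_assoc[OF c(1) f e(1)] c(2)[symmetric] by simp
  ultimately show ?thesis
    using c(1) by simp
qed

lemma (in cring) genideal_insert:
  assumes x: "x \<in> carrier R" and F: "F \<subseteq> carrier R" and b: "b \<in> Idl (insert x F)"
  obtains r t where "r \<in> carrier R" "t \<in> Idl F" "b = r \<otimes> x \<oplus> t"
proof -
  interpret P: ideal "PIdl x" R
    using x by (rule cgenideal_ideal)
  interpret N: ideal "Idl F" R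
    using F by (rule genideal_ideal)
  have "Idl (PIdl x \<union> Idl F) = PIdl x <+>\<^bsub>R\<^esub> Idl F"
    by (rule union_genideal) (rule P.is_ideal, rule N.is_ideal)
  moreover have "Idl (insert x F) \<subseteq> Idl (PIdl x \<union> Idl F)"
    using x F cgenideal_self[OF x] genideal_self[OF F] P.a_subset N.a_subset
    by (intro subset_Idl_subset) auto
  ultimately have "b \<in> PIdl x <+>\<^bsub>R\<^esub> Idl F"
    using b by blast
  then show ?thesis
    using that unfolding set_add_def' cgenideal_def by blast
qed

text \<open>
  Nakayama's lemma by elimination of generators instead of determinants. Suppose a multiplier
  \<open>u\<close> congruent to \<open>1\<close> modulo \<open>I\<close> moves \<open>M\<close> into the ideal generated by \<open>x\<close> and \<open>F\<close>. As
  \<open>x\<close> lies in \<open>I M\<close>, the product \<open>u x\<close> equals \<open>a x\<close> modulo the ideal of \<open>F\<close> for some \<open>a\<close> in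
  \<open>I\<close>, so \<open>u - a\<close> moves \<open>x\<close> into that ideal. The new multiplier \<open>(u - a) u\<close> is still
  congruent to \<open>1\<close> and has eliminated \<open>x\<close>.
\<close>

lemma (in cring) nakayama_unit:
  assumes I: "ideal I R" and M: "ideal M R" "M \<subseteq> ideal_prod R I M"
    and F: "finite F" "F \<subseteq> M"
    and u: "u \<in> carrier R" "\<one> \<ominus> u \<in> I" "\<And>b. b \<in> M \<Longrightarrow> u \<otimes> b \<in> Idl F"
  shows "\<exists>v\<in>carrier R. \<one> \<ominus> v \<in> I \<and> (\<forall>b\<in>M. v \<otimes> b = \<zero>)"
  using F u
proof (induction F arbitrary: u rule: finite_induct)
  case empty
  have "Idl {} = {\<zero>}"
    using genideal_minimal[OF zeroideal, of "{}"] genideal_ideal[of "{}"]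
      additive_subgroup.zero_closed ideal.axioms(1) by blast
  then show ?case
    using empty by blast
next
  case (insert x F)
  interpret I: ideal I R by (rule I)
  interpret M: ideal M R by (rule M)
  have x: "x \<in> M" "x \<in> carrier R" and F: "F \<subseteq> carrier R"
    using insert.prems(1) M.Icarr by auto
  interpret N: ideal "Idl F" R
    using F by (rule genideal_ideal)
  have step: "\<exists>a\<in>I. \<exists>t\<in>Idl F. u \<otimes> c = a \<otimes> x \<oplus> t" if "c \<in> ideal_prod R I M" for c
    using that
  proof (induction rule: ideal_prod.induct)
    case (prod i j)
    obtain r t where rt: "r \<in> carrier R" "t \<in> Idl F" "u \<otimes> j = r \<otimes> x \<oplus> t"
      using genideal_insert[OF x(2) F] insert.prems(4)[OF prod(2)] by blast
    have c: "i \<in> carrier R" "j \<in> carrier R" "t \<in> carrier R"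
      using prod rt(2) I.Icarr M.Icarr N.Icarr by auto
    have "u \<otimes> (i \<otimes> j) = i \<otimes> (u \<otimes> j)"
      using c insert.prems(2) by algebra
    also have "\<dots> = (i \<otimes> r) \<otimes> x \<oplus> i \<otimes> t"
      unfolding rt(3) using c rt(1) x(2) by algebra
    finally show ?case
      using I.I_r_closed[OF prod(1) rt(1)] N.I_l_closed[OF rt(2) c(1)] by blast
  next
    case (sum c d)
    then obtain a t a' t' where at: "a \<in> I" "t \<in> Idl F" "u \<otimes> c = a \<otimes> x \<oplus> t"
      "a' \<in> I" "t' \<in> Idl F" "u \<otimes> d = a' \<otimes> x \<oplus> t'"
      by blast
    have c: "c \<in> carrier R" "d \<in> carrier R"
      using sum ideal_prod_in_carrier[OF I M(1)] by auto
    have a: "a \<in> carrier R" "a' \<in> carrier R" "t \<in> carrier R" "t' \<in> carrier R"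
      using at I.Icarr N.Icarr by auto
    have "u \<otimes> (c \<oplus> d) = u \<otimes> c \<oplus> u \<otimes> d"
      using insert.prems(2) c by (simp add: r_distr)
    also have "\<dots> = (a \<oplus> a') \<otimes> x \<oplus> (t \<oplus> t')"
      unfolding at(3,6) using a x(2) by algebra
    finally show ?case
      using at I.a_closed N.a_closed by blast
  qed
  obtain a t where at: "a \<in> I" "t \<in> Idl F" "u \<otimes> x = a \<otimes> x \<oplus> t"
    using step x(1) M(2) by blast
  have a: "a \<in> carrier R" "t \<in> carrier R"
    using at I.Icarr N.Icarr by auto
  have u: "u \<in> carrier R"
    by (rule insert.prems(2))
  define v where "v = (u \<ominus> a) \<otimes> u"
  have ux: "(u \<ominus> a) \<otimes> x = t"
  proof -
    have "(u \<ominus> a) \<otimes> x = u \<otimes> x \<ominus> a \<otimes> x"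
      using u a x(2) by algebra
    also have "\<dots> = t"
      unfolding at(3) using a x(2) by algebra
    finally show ?thesis .
  qed
  have "v \<in> carrier R"
    using u a by (simp add: v_def)
  moreover have "\<one> \<ominus> v \<in> I"
  proof -
    have "\<one> \<ominus> v = (\<one> \<ominus> u) \<otimes> (\<one> \<oplus> u) \<oplus> a \<otimes> u"
      unfolding v_def using u a by algebra
    then show ?thesis
      using insert.prems(3) at(1) u by (simp add: I.I_r_closed)
  qed
  moreover have "v \<otimes> b \<in> Idl F" if bM: "b \<in> M" for b
  proof -
    obtain r s where rs: "r \<in> carrier R" "s \<in> Idl F" "u \<otimes> b = r \<otimes> x \<oplus> s"
      using genideal_insert[OF x(2) F] insert.prems(4)[OF bM] by blast
    have s: "s \<in> carrier R" and b: "b \<in> carrier R"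
      using rs(2) N.Icarr bM M.Icarr by auto
    have "v \<otimes> b = (u \<ominus> a) \<otimes> (u \<otimes> b)"
      unfolding v_def using u a b by algebra
    also have "\<dots> = r \<otimes> ((u \<ominus> a) \<otimes> x) \<oplus> (u \<ominus> a) \<otimes> s"
      unfolding rs(3) using u a s rs(1) x(2) by algebra
    also have "\<dots> \<in> Idl F"
      unfolding ux using at(2) rs u a by (simp add: N.I_l_closed)
    finally show ?thesis .
  qed
  ultimately show ?case
    using insert.IH insert.prems(1) by blast
qed

text \<open>
  Nakayama's lemma for \<open>M = M\<^sup>2\<close> gives \<open>v\<close> with \<open>v M = 0\<close> and \<open>1 - v\<close> in \<open>M\<close>; the element
  \<open>e = 1 - v\<close> is then an idempotent that generates \<open>M\<close>.
\<close>

lemma (in cring) idempotent_ideal_has_unit: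
  assumes M: "ideal M R" "M \<subseteq> ideal_prod R M M"
    and F: "finite F" "F \<subseteq> M" "M \<subseteq> Idl F"
  obtains e where "e \<in> M" "\<And>b. b \<in> M \<Longrightarrow> e \<otimes> b = b"
proof -
  interpret M: ideal M R by (rule M)
  have "\<exists>v\<in>carrier R. \<one> \<ominus> v \<in> M \<and> (\<forall>b\<in>M. v \<otimes> b = \<zero>)"
  proof (rule nakayama_unit[OF M(1) M F(1,2), of \<one>])
    show "\<one> \<ominus> \<one> \<in> M"
      using M.zero_closed by (simp add: minus_eq r_neg)
    fix b assume "b \<in> M"
    then show "\<one> \<otimes> b \<in> Idl F"
      using F(3) M.Icarr by auto
  qed simp
  then obtain v where v: "v \<in> carrier R" "\<one> \<ominus> v \<in> M" "\<And>b. b \<in> M \<Longrightarrow> v \<otimes> b = \<zero>"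
    by blast
  have "(\<one> \<ominus> v) \<otimes> b = b" if "b \<in> M" for b
  proof -
    have "b \<in> carrier R"
      using that M.Icarr by blast
    then have "(\<one> \<ominus> v) \<otimes> b = b \<ominus> v \<otimes> b"
      using v(1) by algebra
    then show ?thesis
      using v(3)[OF that] \<open>b \<in> carrier R\<close> by (simp add: minus_eq)
  qed
  then show ?thesis
    using that v(2) by blast
qed

section \<open>Idempotents and connected components of affine schemes\<close>

lemma restr_simps [simp]: "pts (restr F U) = U" "arr (restr F U) = arr F"
  by (simp_all add: restr_def)

lemma kfunctor_arr_closed:
  "is_kfunctor K F \<Longrightarrow> A \<in> kalgs K \<Longrightarrow> B \<in> kalgs K \<Longrightarrow> h \<in> kalg_hom K A B \<Longrightarrow> x \<in> pts F A
    \<Longrightarrow> arr F A B h x \<in> pts F B"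
  unfolding is_kfunctor_def by blast

lemma kfunctor_arr_id:
  "is_kfunctor K F \<Longrightarrow> A \<in> kalgs K \<Longrightarrow> x \<in> pts F A \<Longrightarrow> arr F A A (kalg_id A) x = x"
  unfolding is_kfunctor_def by blast

lemma kfunctor_arr_compose:
  "is_kfunctor K F \<Longrightarrow> A \<in> kalgs K \<Longrightarrow> B \<in> kalgs K \<Longrightarrow> C \<in> kalgs K \<Longrightarrow> g \<in> kalg_hom K A B
    \<Longrightarrow> h \<in> kalg_hom K B C \<Longrightarrow> x \<in> pts F A
    \<Longrightarrow> arr F B C h (arr F A B g x) = arr F A C (compose (carrier A) h g) x"
  unfolding is_kfunctor_def by simp

lemma point_of_eq_iff:
  "point_of K F L x = point_of K F M y \<longleftrightarrow>
    ((L, x), (M, y)) \<in> (point_step K F \<union> (point_step K F)\<inverse>)\<^sup>*"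
  (is "_ \<longleftrightarrow> _ \<in> ?r\<^sup>*")
proof -
  have "sym (?r\<^sup>*)"
    by (intro sym_rtrancl sym_Un_converse)
  moreover have "trans (?r\<^sup>*)"
    by (rule trans_rtrancl)
  ultimately show ?thesis
    unfolding point_of_def by (auto dest: symD transD)
qed

lemma point_of_arr:
  assumes "L \<in> kalgs K" "field L" "M \<in> kalgs K" "field M" "h \<in> kalg_hom K L M" "x \<in> pts F L"
  shows "point_of K F M (arr F L M h x) = point_of K F L x"
  unfolding point_of_eq_iff using assms by (intro r_into_rtrancl) (auto simp: point_step_def)

lemma (in field) field_idempotent:
  assumes "e \<in> carrier R" "e \<otimes> e = e"
  shows "e = \<zero> \<or> e = \<one>"
proof -
  have "e \<otimes> (e \<ominus> \<one>) = e \<otimes> e \<ominus> e"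
    using assms(1) by algebra
  also have "\<dots> = \<zero>"
    using assms by (simp add: minus_eq r_neg)
  finally have "e = \<zero> \<or> e \<ominus> \<one> = \<zero>"
    using assms(1) by (simp add: integral_iff)
  then show ?thesis
    using assms(1) by simp
qed

text \<open>
  \<open>F\<close> is represented by \<open>B\<close>, with universal point \<open>z\<close>: this is an affine scheme \<open>Spec B\<close>
  without a choice of isomorphism. The homomorphism \<open>coord C w\<close> below is the one that
  corresponds to the point \<open>w\<close>.
\<close>

locale affine_functor =
  fixes K :: "'a ring" and F :: "('a, 'p) kfunctor" and B :: "'a kalg" and z :: 'p
  assumes kfunctor: "is_kfunctor K F"
    and B: "B \<in> kalgs K"
    and z: "z \<in> pts F B"
    and universal: "C \<in> kalgs K \<Longrightarrow> w \<in> pts F C \<Longrightarrow> \<exists>!h. h \<in> kalg_hom K B C \<and> arr F B C h z = w"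
begin

definition coord :: "'a kalg \<Rightarrow> 'p \<Rightarrow> 'a \<Rightarrow> 'a" where
  "coord C w = (THE h. h \<in> kalg_hom K B C \<and> arr F B C h z = w)"

sublocale B: cring B
  using B by (rule kalgs_cring)

lemma coord_hom: "C \<in> kalgs K \<Longrightarrow> w \<in> pts F C \<Longrightarrow> coord C w \<in> kalg_hom K B C"
  and arr_coord: "C \<in> kalgs K \<Longrightarrow> w \<in> pts F C \<Longrightarrow> arr F B C (coord C w) z = w"
  unfolding coord_def using theI'[OF universal] by auto

lemma coord_eqI:
  assumes "C \<in> kalgs K" "h \<in> kalg_hom K B C" "arr F B C h z = w"
  shows "coord C w = h"
proof -
  have "w \<in> pts F C"
    using kfunctor_arr_closed[OF kfunctor B assms(1,2) z] assms(3) by simp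
  then show ?thesis
    using universal[OF assms(1)] coord_hom arr_coord assms by blast
qed

lemma coord_ring_hom_cring: "C \<in> kalgs K \<Longrightarrow> w \<in> pts F C \<Longrightarrow> ring_hom_cring B C (coord C w)"
  using kalg_hom_ring_hom_cring[OF B] coord_hom by blast

lemma coord_arr:
  assumes "C \<in> kalgs K" "D \<in> kalgs K" "g \<in> kalg_hom K C D" "w \<in> pts F C"
  shows "coord D (arr F C D g w) = compose (carrier B) g (coord C w)"
proof (rule coord_eqI[OF assms(2)])
  show "compose (carrier B) g (coord C w) \<in> kalg_hom K B D"
    using kalg_hom_compose[OF B] coord_hom assms by blast
  show "arr F B D (compose (carrier B) g (coord C w)) z = arr F C D g w"
    using kfunctor_arr_compose[OF kfunctor B assms(1,2) coord_hom assms(3) z] arr_coord assms by simp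
qed

text \<open>
  For an idempotent \<open>e\<close> this is the basic open subscheme \<open>D(e)\<close>, because an idempotent is a unit
  only if it is \<open>1\<close>; its complement is \<open>D(1 - e)\<close>.
\<close>

definition locus :: "'a \<Rightarrow> 'a kalg \<Rightarrow> 'p set" where
  "locus e C = {w \<in> pts F C. coord C w e = \<one>\<^bsub>C\<^esub>}"

lemma locus_arr:
  assumes "C \<in> kalgs K" "D \<in> kalgs K" "g \<in> kalg_hom K C D" "w \<in> pts F C" "e \<in> carrier B"
  shows "arr F C D g w \<in> locus e D \<longleftrightarrow> g (coord C w e) = \<one>\<^bsub>D\<^esub>"
  using coord_arr[OF assms(1-4)] kfunctor_arr_closed[OF kfunctor assms(1-4)] assms(5)
  by (simp add: locus_def compose_def)

lemma coord_idempotent: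
  assumes "C \<in> kalgs K" "w \<in> pts F C" "e \<in> carrier B" "e \<otimes>\<^bsub>B\<^esub> e = e"
  shows "coord C w e \<in> carrier C" "coord C w e \<otimes>\<^bsub>C\<^esub> coord C w e = coord C w e"
proof -
  interpret h: ring_hom_cring B C "coord C w"
    using assms(1,2) by (rule coord_ring_hom_cring)
  show "coord C w e \<in> carrier C"
    using assms(3) by simp
  show "coord C w e \<otimes>\<^bsub>C\<^esub> coord C w e = coord C w e"
    using assms(3,4) h.hom_mult[of e e] by simp
qed

lemma open_locus:
  assumes e: "e \<in> carrier B" "e \<otimes>\<^bsub>B\<^esub> e = e"
  shows "open_subfunctor K F (locus e)"
  unfolding open_subfunctor_def subfunctor_def
proof (intro conjI allI ballI)
  show "locus e A \<subseteq> pts F A" for A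
    by (auto simp: locus_def)
next
  fix A C h assume A: "A \<in> kalgs K" and C: "C \<in> kalgs K" and h: "h \<in> kalg_hom K A C"
  interpret h: ring_hom_cring A C h
    using A C h by (rule kalg_hom_ring_hom_cring)
  show "arr F A C h \<in> locus e A \<rightarrow> locus e C"
    using locus_arr[OF A C h _ e(1)] h.hom_one by (auto simp: locus_def)
next
  fix A x assume A: "A \<in> kalgs K" and x: "x \<in> pts F A"
  interpret A: cring A
    using A by (rule kalgs_cring)
  define f where "f = coord A x e"
  have f: "f \<in> carrier A" "f \<otimes>\<^bsub>A\<^esub> f = f"
    unfolding f_def using coord_idempotent[OF A x e] by blast+
  show "\<exists>I. ideal I A \<and> (\<forall>C\<in>kalgs K. \<forall>h\<in>kalg_hom K A C.
    (arr F A C h x \<in> locus e C) = (Idl\<^bsub>C\<^esub> (h ` I) = carrier C))"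
  proof (intro exI conjI ballI)
    show "ideal (PIdl\<^bsub>A\<^esub> f) A"
      using f(1) by (rule A.cgenideal_ideal)
    fix C h assume C: "C \<in> kalgs K" and h: "h \<in> kalg_hom K A C"
    interpret C: cring C
      using C by (rule kalgs_cring)
    interpret h: ring_hom_cring A C h
      using A C h by (rule kalg_hom_ring_hom_cring)
    have sub: "h ` (PIdl\<^bsub>A\<^esub> f) \<subseteq> PIdl\<^bsub>C\<^esub> (h f)"
      using f(1) by (auto simp: cgenideal_def)
    have PC: "ideal (PIdl\<^bsub>C\<^esub> (h f)) C"
      using f(1) by (intro C.cgenideal_ideal) simp
    have carr: "h ` (PIdl\<^bsub>A\<^esub> f) \<subseteq> carrier C"
      using sub additive_subgroup.a_subset[OF ideal.axioms(1)[OF PC]] by (rule subset_trans)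
    have "h f = \<one>\<^bsub>C\<^esub> \<longleftrightarrow> Idl\<^bsub>C\<^esub> (h ` (PIdl\<^bsub>A\<^esub> f)) = carrier C"
    proof
      assume "h f = \<one>\<^bsub>C\<^esub>"
      then have "\<one>\<^bsub>C\<^esub> \<in> Idl\<^bsub>C\<^esub> (h ` (PIdl\<^bsub>A\<^esub> f))"
        using imageI[OF A.cgenideal_self[OF f(1)], of h] subsetD[OF C.genideal_self[OF carr]]
        by metis
      then show "Idl\<^bsub>C\<^esub> (h ` (PIdl\<^bsub>A\<^esub> f)) = carrier C"
        using ideal.one_imp_carrier[OF C.genideal_ideal[OF carr]] by blast
    next
      assume "Idl\<^bsub>C\<^esub> (h ` (PIdl\<^bsub>A\<^esub> f)) = carrier C"
      then have "\<one>\<^bsub>C\<^esub> \<in> PIdl\<^bsub>C\<^esub> (h f)"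
        using C.genideal_minimal[OF PC sub] by auto
      then obtain c where c: "c \<in> carrier C" "\<one>\<^bsub>C\<^esub> = c \<otimes>\<^bsub>C\<^esub> h f"
        by (auto simp: cgenideal_def)
      have ff: "h f \<otimes>\<^bsub>C\<^esub> h f = h f" and hf: "h f \<in> carrier C"
        using f h.hom_mult[of f f] by simp_all
      have "h f = (c \<otimes>\<^bsub>C\<^esub> h f) \<otimes>\<^bsub>C\<^esub> h f"
        using hf by (simp flip: c(2))
      also have "\<dots> = \<one>\<^bsub>C\<^esub>"
        using c hf ff by (simp add: C.m_assoc)
      finally show "h f = \<one>\<^bsub>C\<^esub>" .
    qed
    then show "arr F A C h x \<in> locus e C \<longleftrightarrow> Idl\<^bsub>C\<^esub> (h ` (PIdl\<^bsub>A\<^esub> f)) = carrier C"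
      using locus_arr[OF A C h x e(1)] by (simp add: f_def)
  qed
qed

text \<open>
  A field has only the idempotents \<open>0\<close> and \<open>1\<close>, and homomorphisms of fields keep them apart.
  So whether a field-valued point lies in \<open>D(e)\<close> depends only on the point of the underlying
  space that it represents.
\<close>

lemma locus_point_step:
  assumes e: "e \<in> carrier B" "e \<otimes>\<^bsub>B\<^esub> e = e" and step: "((L, x), (M, y)) \<in> point_step K F"
  shows "x \<in> locus e L \<longleftrightarrow> y \<in> locus e M"
proof -
  obtain h where L: "L \<in> kalgs K" "field L" and M: "M \<in> kalgs K" "field M"
    and h: "h \<in> kalg_hom K L M" and x: "x \<in> pts F L" and y: "y = arr F L M h x"
    using step unfolding point_step_def by blast
  interpret L: field L by (rule L(2))
  interpret M: field M by (rule M(2))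
  interpret h: ring_hom_cring L M h
    using L(1) M(1) h by (rule kalg_hom_ring_hom_cring)
  have "coord L x e = \<zero>\<^bsub>L\<^esub> \<or> coord L x e = \<one>\<^bsub>L\<^esub>"
    using L.field_idempotent coord_idempotent[OF L(1) x e] by blast
  then show ?thesis
    using x unfolding y locus_arr[OF L(1) M(1) h x e(1)] by (auto simp: locus_def)
qed

lemma point_in_points_locus:
  assumes e: "e \<in> carrier B" "e \<otimes>\<^bsub>B\<^esub> e = e"
    and L: "L \<in> kalgs K" "field L" and x: "x \<in> pts F L"
  shows "point_of K F L x \<in> points K F (locus e) \<longleftrightarrow> x \<in> locus e L"
proof
  assume "x \<in> locus e L"
  then show "point_of K F L x \<in> points K F (locus e)"
    using L by (auto simp: points_def)
next
  assume "point_of K F L x \<in> points K F (locus e)"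
  then obtain M y where "y \<in> locus e M" "point_of K F M y = point_of K F L x"
    by (auto simp: points_def)
  then have "((M, y), (L, x)) \<in> (point_step K F \<union> (point_step K F)\<inverse>)\<^sup>*"
    by (simp add: point_of_eq_iff)
  then show "x \<in> locus e L"
    using \<open>y \<in> locus e M\<close>
  proof (induction rule: rtrancl_induct2)
    case (step M y N w)
    then show ?case
      using locus_point_step[OF e, of M y N w] locus_point_step[OF e, of N w M y] by auto
  qed
qed

text \<open>
  The disjoint open sets \<open>D(e)\<close> and \<open>D(1 - e)\<close> cover the space, so the component of a point of
  \<open>D(1 - e)\<close> avoids \<open>D(e)\<close>. Hence for \<open>w\<close> in the open subscheme on that component the value of
  \<open>e\<close> at \<open>w\<close> is an idempotent that vanishes in every field, which makes it zero.
\<close>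

lemma connected_component_kills_idempotent:
  assumes e: "e \<in> carrier B" "e \<otimes>\<^bsub>B\<^esub> e = e"
    and L0: "L0 \<in> kalgs K" "field L0" "x0 \<in> pts F L0" "coord L0 x0 e = \<zero>\<^bsub>L0\<^esub>"
    and A: "A \<in> kalgs K"
    and w: "w \<in> sub_on K F (connected_component_of_set (space_of K F) (point_of K F L0 x0)) A"
  shows "coord A w e = \<zero>\<^bsub>A\<^esub>"
proof -
  define f where "f = \<one>\<^bsub>B\<^esub> \<ominus>\<^bsub>B\<^esub> e"
  have f: "f \<in> carrier B" "f \<otimes>\<^bsub>B\<^esub> f = f"
  proof -
    show "f \<in> carrier B"
      using e by (simp add: f_def)
    have "f \<otimes>\<^bsub>B\<^esub> f = \<one>\<^bsub>B\<^esub> \<ominus>\<^bsub>B\<^esub> e \<ominus>\<^bsub>B\<^esub> e \<oplus>\<^bsub>B\<^esub> e \<otimes>\<^bsub>B\<^esub> e"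
      unfolding f_def using e(1) by algebra
    also have "\<dots> = f"
      unfolding e(2) f_def using e(1) by algebra
    finally show "f \<otimes>\<^bsub>B\<^esub> f = f" .
  qed
  have coord_f: "coord C x f = \<one>\<^bsub>C\<^esub> \<ominus>\<^bsub>C\<^esub> coord C x e" if "C \<in> kalgs K" "x \<in> pts F C" for C x
  proof -
    interpret h: ring_hom_cring B C "coord C x"
      using that by (rule coord_ring_hom_cring)
    show ?thesis
      using e(1) by (simp add: f_def B.minus_eq h.S.minus_eq)
  qed
  have opens: "openin (space_of K F) (points K F (locus g))"
    if "g \<in> carrier B" "g \<otimes>\<^bsub>B\<^esub> g = g" for g
    unfolding space_of_def using open_locus[OF that]
    by (intro topology_generated_by_Basis) blast
  have locus_field: "x \<in> locus f L \<longleftrightarrow> x \<notin> locus e L"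
    if L: "L \<in> kalgs K" "field L" and x: "x \<in> pts F L" for L x
  proof -
    interpret L: field L by (rule L(2))
    have "coord L x e = \<zero>\<^bsub>L\<^esub> \<or> coord L x e = \<one>\<^bsub>L\<^esub>"
      using L.field_idempotent coord_idempotent[OF L(1) x e] by blast
    then show ?thesis
      using x coord_f[OF L(1) x] by (auto simp: locus_def L.minus_eq L.r_neg)
  qed
  have cover: "topspace (space_of K F) \<subseteq> points K F (locus e) \<union> points K F (locus f)"
  proof
    fix p assume "p \<in> topspace (space_of K F)"
    then obtain U L x where "open_subfunctor K F U" "L \<in> kalgs K" "field L" "x \<in> U L"
      "p = point_of K F L x"
      by (auto simp: space_of_def points_def)
    moreover from this have "x \<in> pts F L"
      unfolding open_subfunctor_def subfunctor_def by blast
    ultimately have "x \<in> locus e L \<or> x \<in> locus f L"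
      using locus_field by blast
    then show "p \<in> points K F (locus e) \<union> points K F (locus f)"
      using \<open>L \<in> kalgs K\<close> \<open>field L\<close> \<open>p = point_of K F L x\<close> unfolding points_def by blast
  qed
  have disjoint: "points K F (locus e) \<inter> points K F (locus f) = {}"
  proof (rule ccontr)
    assume "points K F (locus e) \<inter> points K F (locus f) \<noteq> {}"
    then obtain p where p: "p \<in> points K F (locus e)" "p \<in> points K F (locus f)"
      by blast
    from p(2) obtain L x where L: "L \<in> kalgs K" "field L" "x \<in> locus f L" "p = point_of K F L x"
      unfolding points_def by blast
    moreover from L(3) have "x \<in> pts F L"
      by (simp add: locus_def)
    ultimately show False
      using point_in_points_locus[OF e L(1,2)] locus_field[OF L(1,2)] p(1) by blast
  qed
  interpret L0: field L0 by (rule L0(2))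
  have base: "point_of K F L0 x0 \<in> points K F (locus f)"
  proof -
    have "x0 \<notin> locus e L0"
      using L0(4) by (simp add: locus_def)
    then show ?thesis
      using locus_field[OF L0(1-3)] L0 by (auto simp: points_def)
  qed
  have comp: "p \<notin> points K F (locus e)"
    if p: "p \<in> connected_component_of_set (space_of K F) (point_of K F L0 x0)" for p
  proof
    assume pe: "p \<in> points K F (locus e)"
    obtain T where T: "connectedin (space_of K F) T" "point_of K F L0 x0 \<in> T" "p \<in> T"
      using p by (auto simp: connected_component_of_def)
    show False
      using connectedinD[OF T(1) opens[OF e] opens[OF f]] connectedin_subset_topspace[OF T(1)]
        cover disjoint base pe T(2,3) by blast
  qed
  have wA: "w \<in> pts F A"
    using w by (simp add: sub_on_def)
  show ?thesis
  proof (rule idempotent_eq_zeroI[OF A coord_idempotent[OF A wA e]])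
    fix L h assume L: "L \<in> kalgs K" "field L" and h: "h \<in> kalg_hom K A L"
    interpret L: field L by (rule L(2))
    interpret h: ring_hom_cring A L h
      using A L(1) h by (rule kalg_hom_ring_hom_cring)
    have hw: "arr F A L h w \<in> pts F L"
      using kfunctor_arr_closed[OF kfunctor A L(1) h wA] .
    have "point_of K F L (arr F A L h w) \<notin> points K F (locus e)"
      using w L h comp by (auto simp: sub_on_def)
    then have "h (coord A w e) \<noteq> \<one>\<^bsub>L\<^esub>"
      using point_in_points_locus[OF e L hw] locus_arr[OF A L(1) h wA e(1)] by blast
    moreover have "h (coord A w e) = \<zero>\<^bsub>L\<^esub> \<or> h (coord A w e) = \<one>\<^bsub>L\<^esub>"
      using L.field_idempotent coord_idempotent[OF A wA e] h.hom_mult h.hom_closed by metis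
    ultimately show "h (coord A w e) = \<zero>\<^bsub>L\<^esub>"
      by blast
  qed
qed

lemma point_in_topspace:
  assumes "L \<in> kalgs K" "field L" "x \<in> pts F L"
  shows "point_of K F L x \<in> topspace (space_of K F)"
proof -
  interpret h: ring_hom_cring B L "coord L x"
    using assms(1,3) by (rule coord_ring_hom_cring)
  have "x \<in> locus \<one>\<^bsub>B\<^esub> L"
    using assms(3) h.hom_one by (simp add: locus_def)
  then have "point_of K F L x \<in> points K F (locus \<one>\<^bsub>B\<^esub>)"
    using assms(1,2) by (auto simp: points_def)
  moreover have "open_subfunctor K F (locus \<one>\<^bsub>B\<^esub>)"
    by (rule open_locus) simp_all
  ultimately show ?thesis
    unfolding space_of_def topology_generated_by_topspace by blast
qed

end

section \<open>Open subfunctors and square-zero thickenings\<close>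

lemma surj_image_ideal:
  assumes "ring_hom_cring R S h" "h ` carrier R = carrier S" "ideal I R"
  shows "ideal (h ` I) S"
proof -
  interpret h: ring_hom_cring R S h by fact
  interpret I: ideal I R by fact
  have lift: "\<exists>a\<in>carrier R. y = h a" if "y \<in> carrier S" for y
    using that assms(2) by blast
  show ?thesis
  proof (rule idealI[OF h.S.ring_axioms])
    show "subgroup (h ` I) (add_monoid S)"
      using h.ring.img_is_add_subgroup I.a_subgroup by blast
    fix y x assume "y \<in> h ` I" "x \<in> carrier S"
    then obtain a where a: "a \<in> I" "y = h a"
      by blast
    obtain b where b: "b \<in> carrier R" "x = h b"
      using lift[OF \<open>x \<in> carrier S\<close>] by blast
    note ab = a(1) b(1) a(2) b(2)
    then have "h b \<otimes>\<^bsub>S\<^esub> h a = h (b \<otimes>\<^bsub>R\<^esub> a)" "h a \<otimes>\<^bsub>S\<^esub> h b = h (a \<otimes>\<^bsub>R\<^esub> b)"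
      using I.Icarr by simp_all
    then show "x \<otimes>\<^bsub>S\<^esub> y \<in> h ` I" "y \<otimes>\<^bsub>S\<^esub> x \<in> h ` I"
      unfolding ab(3,4) using I.I_l_closed[OF ab(1,2)] I.I_r_closed[OF ab(1,2)] by (metis imageI)+
  qed
qed

text \<open>
  Open conditions do not see nilpotents. If the ideal \<open>I\<close> that cuts out the complement of \<open>U\<close> along \<open>x\<close>
  becomes the unit ideal modulo a square-zero ideal, it contains \<open>i = 1 - d\<close> with \<open>d\<^sup>2 = 0\<close>,
  which is a unit with inverse \<open>1 + d\<close>.
\<close>

lemma open_subfunctor_thickening:
  assumes F: "is_kfunctor K F" and U: "open_subfunctor K F U"
    and A: "A \<in> kalgs K" and C: "C \<in> kalgs K"
    and q: "q \<in> kalg_hom K A C" "q ` carrier A = carrier C"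
    and square_zero: "\<And>a b. a \<in> carrier A \<Longrightarrow> b \<in> carrier A \<Longrightarrow> q a = \<zero>\<^bsub>C\<^esub> \<Longrightarrow> q b = \<zero>\<^bsub>C\<^esub> \<Longrightarrow> a \<otimes>\<^bsub>A\<^esub> b = \<zero>\<^bsub>A\<^esub>"
    and x: "x \<in> pts F A" "arr F A C q x \<in> U C"
  shows "x \<in> U A"
proof -
  interpret A: cring A
    using A by (rule kalgs_cring)
  interpret C: cring C
    using C by (rule kalgs_cring)
  interpret q: ring_hom_cring A C q
    using A C q(1) by (rule kalg_hom_ring_hom_cring)
  obtain I where I: "ideal I A"
    and mem: "\<And>D h. D \<in> kalgs K \<Longrightarrow> h \<in> kalg_hom K A D \<Longrightarrow>
      arr F A D h x \<in> U D \<longleftrightarrow> Idl\<^bsub>D\<^esub> (h ` I) = carrier D"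
    using U A x(1) unfolding open_subfunctor_def by metis
  interpret I: ideal I A by (rule I)
  have "ideal (q ` I) C"
    using surj_image_ideal[OF q.ring_hom_cring_axioms q(2) I] .
  then have "Idl\<^bsub>C\<^esub> (q ` I) \<subseteq> q ` I"
    using C.genideal_minimal by blast
  then have "\<one>\<^bsub>C\<^esub> \<in> q ` I"
    using mem[OF C q(1)] x(2) by auto
  then obtain i where i: "i \<in> I" "q i = \<one>\<^bsub>C\<^esub>"
    by auto
  define d where "d = \<one>\<^bsub>A\<^esub> \<ominus>\<^bsub>A\<^esub> i"
  have iA: "i \<in> carrier A" and d: "d \<in> carrier A"
    using i(1) I.Icarr by (auto simp: d_def)
  have "q d = \<zero>\<^bsub>C\<^esub>"
    using iA i(2) by (simp add: d_def A.minus_eq C.r_neg)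
  then have "d \<otimes>\<^bsub>A\<^esub> d = \<zero>\<^bsub>A\<^esub>"
    using square_zero d by blast
  moreover have "i \<otimes>\<^bsub>A\<^esub> (\<one>\<^bsub>A\<^esub> \<oplus>\<^bsub>A\<^esub> d) \<oplus>\<^bsub>A\<^esub> d \<otimes>\<^bsub>A\<^esub> d = \<one>\<^bsub>A\<^esub>"
    unfolding d_def using iA by algebra
  ultimately have "i \<otimes>\<^bsub>A\<^esub> (\<one>\<^bsub>A\<^esub> \<oplus>\<^bsub>A\<^esub> d) = \<one>\<^bsub>A\<^esub>"
    using iA d by simp
  then have "\<one>\<^bsub>A\<^esub> \<in> I"
    using I.I_r_closed[OF i(1), of "\<one>\<^bsub>A\<^esub> \<oplus>\<^bsub>A\<^esub> d"] d by simp
  then have "I = carrier A"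
    by (rule I.one_imp_carrier)
  then have "kalg_id A ` I = I"
    by (auto simp: kalg_id_def)
  moreover have "Idl\<^bsub>A\<^esub> I = carrier A"
    using \<open>I = carrier A\<close> A.genideal_self[of "carrier A"] ideal.Icarr[OF A.genideal_ideal[of "carrier A"]]
    by auto
  ultimately show ?thesis
    using mem[OF A kalg_id_hom[OF A]] kfunctor_arr_id[OF F A x(1)] by simp
qed

section \<open>The component of the base point in a finite unramified fibre\<close>

lemma mor_closed: "\<eta> \<in> mor K F G \<Longrightarrow> x \<in> pts F A \<Longrightarrow> \<eta> A x \<in> pts G A"
  unfolding mor_def by blast

lemma mor_natural:
  "\<eta> \<in> mor K F G \<Longrightarrow> A \<in> kalgs K \<Longrightarrow> B \<in> kalgs K \<Longrightarrow> h \<in> kalg_hom K A B \<Longrightarrow> x \<in> pts F A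
    \<Longrightarrow> \<eta> B (arr F A B h x) = arr G A B h (\<eta> A x)"
  unfolding mor_def by blast

lemma mor_undefined: "\<eta> \<in> mor K F G \<Longrightarrow> x \<notin> pts F A \<Longrightarrow> \<eta> A x = undefined"
  unfolding mor_def by (auto simp: PiE_def extensional_def)

lemma mor_eqI:
  assumes "\<eta> \<in> mor K F G" "\<theta> \<in> mor K F G'" "\<And>A x. x \<in> pts F A \<Longrightarrow> \<eta> A x = \<theta> A x"
  shows "\<eta> = \<theta>"
proof (intro ext)
  fix A x
  show "\<eta> A x = \<theta> A x"
    using assms(3) mor_undefined[OF assms(1)] mor_undefined[OF assms(2)]
    by (cases "x \<in> pts F A") simp_all
qed

lemma mor_comp_apply: "x \<in> pts F A \<Longrightarrow> mor_comp F \<theta> \<eta> A x = \<theta> A (\<eta> A x)"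
  by (simp add: mor_comp_def compose_def)

locale pointed_functor =
  fixes K :: "'a ring" and Y :: "('a, 'p) kfunctor" and y\<^sub>0 :: 'p
  assumes K: "field K"
    and Y: "is_kfunctor K Y"
    and y\<^sub>0: "y\<^sub>0 \<in> pts Y (base_alg K)"
begin

sublocale K: field K
  by (rule K)

lemma base: "base_alg K \<in> kalgs K" "field (base_alg K)"
  using base_alg_kalgs[OF K.is_cring] base_alg_field[OF K] .

lemma base_pt_closed: "A \<in> kalgs K \<Longrightarrow> base_pt K Y y\<^sub>0 A \<in> pts Y A"
  unfolding base_pt_def using kfunctor_arr_closed[OF Y base(1) _ unit_hom_kalg_hom y\<^sub>0] .

lemma unit_hom_base: "unit_hom K (base_alg K) = kalg_id (base_alg K)"
  using base_alg_hom_unique[OF K.is_cring kalg_id_hom[OF base(1)]] by simp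

lemma base_pt_base: "base_pt K Y y\<^sub>0 (base_alg K) = y\<^sub>0"
  unfolding base_pt_def unit_hom_base using kfunctor_arr_id[OF Y base(1) y\<^sub>0] .

lemma arr_base_pt:
  assumes "A \<in> kalgs K" "B \<in> kalgs K" "h \<in> kalg_hom K A B"
  shows "arr Y A B h (base_pt K Y y\<^sub>0 A) = base_pt K Y y\<^sub>0 B"
proof -
  have "compose (carrier (base_alg K)) h (unit_hom K A) = unit_hom K B"
    using base_alg_hom_unique[OF K.is_cring] kalg_hom_compose[OF base(1) unit_hom_kalg_hom] assms
    by blast
  then show ?thesis
    unfolding base_pt_def
    using kfunctor_arr_compose[OF Y base(1) assms(1,2) unit_hom_kalg_hom assms(3) y\<^sub>0] assms(1)
    by simp
qed

end

locale pointed_endo = pointed_functor K Y y\<^sub>0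
  for K :: "'a ring" and Y :: "('a, 'p) kfunctor" and y\<^sub>0 :: 'p +
  fixes s :: "'a kalg \<Rightarrow> 'p \<Rightarrow> 'p"
  assumes s: "s \<in> mor K Y Y" and s_y\<^sub>0: "s (base_alg K) y\<^sub>0 = y\<^sub>0"
begin

abbreviation X\<^sub>s :: "('a, 'p) kfunctor" where
  "X\<^sub>s \<equiv> fibre K Y y\<^sub>0 s"

lemma s_base_pt: "A \<in> kalgs K \<Longrightarrow> s A (base_pt K Y y\<^sub>0 A) = base_pt K Y y\<^sub>0 A"
  unfolding base_pt_def
  using mor_natural[OF s base(1) _ unit_hom_kalg_hom y\<^sub>0] s_y\<^sub>0 by simp

lemma arr_fibre [simp]: "arr X\<^sub>s = arr Y"
  by (simp add: fibre_def)

lemma fibre_iff: "y \<in> pts X\<^sub>s A \<longleftrightarrow> y \<in> pts Y A \<and> s A y = base_pt K Y y\<^sub>0 A"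
  by (simp add: fibre_def)

lemma fibre_kfunctor: "is_kfunctor K X\<^sub>s"
proof -
  have "arr Y A B h x \<in> pts X\<^sub>s B"
    if "A \<in> kalgs K" "B \<in> kalgs K" "h \<in> kalg_hom K A B" "x \<in> pts X\<^sub>s A" for A B h x
    using that mor_natural[OF s that(1-3)] arr_base_pt[OF that(1-3)] kfunctor_arr_closed[OF Y that(1-3)]
    by (simp add: fibre_iff)
  then show ?thesis
    using Y unfolding is_kfunctor_def by (auto simp: fibre_iff)
qed

lemma base_pt_in_fibre: "A \<in> kalgs K \<Longrightarrow> base_pt K Y y\<^sub>0 A \<in> pts X\<^sub>s A"
  using base_pt_closed s_base_pt by (simp add: fibre_iff)

lemma y\<^sub>0_in_fibre: "y\<^sub>0 \<in> pts X\<^sub>s (base_alg K)"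
  using base_pt_in_fibre[OF base(1)] base_pt_base by simp

text \<open>
  The fibre is the base change of \<open>s\<close> along \<open>y\<^sub>0 : Spec K \<rightarrow> Y\<close>, so finiteness of \<open>s\<close> presents it
  as \<open>Spec B\<close> with \<open>B\<close> finite over \<open>K\<close>. The compatibility with the structure maps
  that the base change demands is automatic because \<open>K\<close> is initial.
\<close>

lemma finite_imp_affine_fibre:
  assumes "finite_mor K Y Y s"
  obtains B z where "affine_functor K X\<^sub>s B z" "module_finite (base_alg K) B (unit_hom K B)"
proof -
  obtain B l z where B: "B \<in> kalgs K" and l: "l \<in> kalg_hom K (base_alg K) B" and z: "z \<in> pts Y B"
    and fin: "module_finite (base_alg K) B l" and sz: "s B z = arr Y (base_alg K) B l y\<^sub>0"
    and univ: "\<And>C g w. C \<in> kalgs K \<Longrightarrow> g \<in> kalg_hom K (base_alg K) C \<Longrightarrow> w \<in> pts Y C \<Longrightarrow>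
      s C w = arr Y (base_alg K) C g y\<^sub>0 \<Longrightarrow>
      \<exists>!h. h \<in> kalg_hom K B C \<and> compose (carrier (base_alg K)) h l = g \<and> arr Y B C h z = w"
    using assms[unfolded finite_mor_def, THEN conjunct2, rule_format, OF base(1) y\<^sub>0] by blast
  have l_eq: "l = unit_hom K B"
    using base_alg_hom_unique[OF K.is_cring l] .
  have "affine_functor K X\<^sub>s B z"
  proof
    show "is_kfunctor K X\<^sub>s" "B \<in> kalgs K"
      using fibre_kfunctor B .
    show "z \<in> pts X\<^sub>s B"
      using z sz by (simp add: fibre_iff l_eq base_pt_def)
    fix C w assume C: "C \<in> kalgs K" and w: "w \<in> pts X\<^sub>s C"
    have over_K: "compose (carrier (base_alg K)) h l = unit_hom K C" if "h \<in> kalg_hom K B C" for h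
      using base_alg_hom_unique[OF K.is_cring kalg_hom_compose[OF base(1) l that]] .
    have "\<exists>!h. h \<in> kalg_hom K B C \<and> compose (carrier (base_alg K)) h l = unit_hom K C \<and>
      arr Y B C h z = w"
      using univ[OF C unit_hom_kalg_hom[OF C]] w by (simp add: fibre_iff base_pt_def)
    then show "\<exists>!h. h \<in> kalg_hom K B C \<and> arr X\<^sub>s B C h z = w"
      using over_K unfolding arr_fibre by (elim ex1E, intro ex1I) blast+
  qed
  then show ?thesis
    using that fin l_eq by blast
qed

end

locale affine_fibre = pointed_endo K Y y\<^sub>0 s + affine_functor K "fibre K Y y\<^sub>0 s" B z
  for K :: "'a ring" and Y :: "('a, 'p) kfunctor" and y\<^sub>0 s B z
begin

text \<open>
  The rational point \<open>y\<^sub>0\<close> of the fibre is an augmentation \<open>\<epsilon> : B \<rightarrow> K\<close>, with kernel the maximal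
  ideal \<open>\<mm>\<close> at \<open>y\<^sub>0\<close>.
\<close>

definition \<epsilon> :: "'a \<Rightarrow> 'a" where
  "\<epsilon> = coord (base_alg K) y\<^sub>0"

definition \<mm> :: "'a set" where
  "\<mm> = {b \<in> carrier B. \<epsilon> b = \<zero>\<^bsub>K\<^esub>}"

lemma \<epsilon>_hom: "\<epsilon> \<in> kalg_hom K B (base_alg K)"
  unfolding \<epsilon>_def using coord_hom[OF base(1) y\<^sub>0_in_fibre] .

sublocale \<epsilon>: ring_hom_cring B "base_alg K" \<epsilon>
  using kalg_hom_ring_hom_cring[OF B base(1) \<epsilon>_hom] .

sublocale \<eta>: ring_hom_cring "base_alg K" B "unit_hom K B"
  using kalg_hom_ring_hom_cring[OF base(1) B unit_hom_kalg_hom[OF B]] .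

lemma \<epsilon>_unit: "k \<in> carrier K \<Longrightarrow> \<epsilon> (unit_hom K B k) = k"
  using fun_cong[OF base_alg_hom_unique[OF K.is_cring
    kalg_hom_compose[OF base(1) unit_hom_kalg_hom[OF B] \<epsilon>_hom]], of k]
  by (simp add: unit_hom_base kalg_id_def compose_def)

lemma \<epsilon>_closed [simp]: "b \<in> carrier B \<Longrightarrow> \<epsilon> b \<in> carrier K"
  using \<epsilon>.hom_closed by simp

lemma unit_closed [simp]: "k \<in> carrier K \<Longrightarrow> unit_hom K B k \<in> carrier B"
  using \<eta>.hom_closed by simp

lemma \<mm>_ideal: "ideal \<mm> B"
proof -
  have "\<mm> = a_kernel B (base_alg K) \<epsilon>"
    unfolding \<mm>_def a_kernel_def kernel_def by simp
  then show ?thesis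
    using \<epsilon>.ring.kernel_is_ideal by (rule ssubst)
qed

lemma \<mm>_carrier: "b \<in> \<mm> \<Longrightarrow> b \<in> carrier B"
  by (simp add: \<mm>_def)

lemma diff_in_\<mm>:
  assumes "b \<in> carrier B"
  shows "b \<ominus>\<^bsub>B\<^esub> unit_hom K B (\<epsilon> b) \<in> \<mm>"
proof -
  have "\<epsilon> (b \<ominus>\<^bsub>B\<^esub> unit_hom K B (\<epsilon> b)) = \<epsilon> b \<ominus>\<^bsub>base_alg K\<^esub> \<epsilon> b"
    using assms \<epsilon>_unit[of "\<epsilon> b"] by (simp add: B.minus_eq \<epsilon>.S.minus_eq)
  also have "\<dots> = \<zero>\<^bsub>K\<^esub>"
    using \<epsilon>.hom_closed[OF assms] \<epsilon>.S.r_right_minus_eq by simp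
  finally show ?thesis
    using assms by (simp add: \<mm>_def)
qed

text \<open>
  The projection \<open>b \<mapsto> b - \<epsilon>(b)\<close> of \<open>B\<close> onto \<open>\<mm>\<close> is \<open>K\<close>-linear, so it carries module
  generators of \<open>B\<close> to generators of \<open>\<mm>\<close>.
\<close>

lemma \<mm>_finitely_generated:
  assumes "module_finite (base_alg K) B (unit_hom K B)"
  obtains F where "finite F" "F \<subseteq> \<mm>" "\<mm> \<subseteq> Idl\<^bsub>B\<^esub> F"
proof -
  obtain G where G: "finite G" "G \<subseteq> carrier B"
    and gen: "\<And>b. b \<in> carrier B \<Longrightarrow>
      \<exists>c\<in>G \<rightarrow> carrier K. b = (\<Oplus>\<^bsub>B\<^esub>g\<in>G. unit_hom K B (c g) \<otimes>\<^bsub>B\<^esub> g)"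
    using assms unfolding module_finite_def by auto
  define \<pi> where "\<pi> b = b \<ominus>\<^bsub>B\<^esub> unit_hom K B (\<epsilon> b)" for b
  define F where "F = \<pi> ` G"
  have F: "F \<subseteq> \<mm>"
    using G(2) diff_in_\<mm> by (auto simp: F_def \<pi>_def)
  then have FB: "F \<subseteq> carrier B"
    using \<mm>_carrier by blast
  interpret N: ideal "Idl\<^bsub>B\<^esub> F" B
    using FB by (rule B.genideal_ideal)
  have gen_mem: "\<pi> (unit_hom K B k \<otimes>\<^bsub>B\<^esub> g) \<in> Idl\<^bsub>B\<^esub> F" if "k \<in> carrier K" "g \<in> G" for k g
  proof -
    have g: "g \<in> carrier B"
      using that(2) G(2) by blast
    have "unit_hom K B (\<epsilon> (unit_hom K B k \<otimes>\<^bsub>B\<^esub> g)) = unit_hom K B k \<otimes>\<^bsub>B\<^esub> unit_hom K B (\<epsilon> g)"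
      using that(1) g \<epsilon>_unit \<eta>.hom_mult[of k "\<epsilon> g"] by simp
    then have "\<pi> (unit_hom K B k \<otimes>\<^bsub>B\<^esub> g) = unit_hom K B k \<otimes>\<^bsub>B\<^esub> \<pi> g"
      unfolding \<pi>_def using that(1) g by (simp add: B.minus_eq B.r_distr B.r_minus)
    moreover have "\<pi> g \<in> Idl\<^bsub>B\<^esub> F"
      using B.genideal_self[OF FB] that(2) by (auto simp: F_def)
    ultimately show ?thesis
      using N.I_l_closed that(1) by simp
  qed
  have add: "\<pi> (a \<oplus>\<^bsub>B\<^esub> b) = \<pi> a \<oplus>\<^bsub>B\<^esub> \<pi> b" if "a \<in> carrier B" "b \<in> carrier B" for a b
  proof -
    have "unit_hom K B (\<epsilon> (a \<oplus>\<^bsub>B\<^esub> b)) = unit_hom K B (\<epsilon> a) \<oplus>\<^bsub>B\<^esub> unit_hom K B (\<epsilon> b)"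
      using that \<eta>.hom_add[of "\<epsilon> a" "\<epsilon> b"] by simp
    then show ?thesis
      unfolding \<pi>_def using that by (simp add: B.minus_eq B.minus_add B.a_ac)
  qed
  have sum: "\<pi> (\<Oplus>\<^bsub>B\<^esub>g\<in>H. unit_hom K B (c g) \<otimes>\<^bsub>B\<^esub> g) \<in> Idl\<^bsub>B\<^esub> F"
    if "c \<in> G \<rightarrow> carrier K" "H \<subseteq> G" for c H
    using finite_subset[OF that(2) G(1)] that(2)
  proof (induction H rule: finite_induct)
    case empty
    have "\<pi> \<zero>\<^bsub>B\<^esub> = \<zero>\<^bsub>B\<^esub>"
      using \<epsilon>.hom_zero \<eta>.hom_zero by (simp add: \<pi>_def B.minus_eq)
    then show ?case
      using N.zero_closed by simp
  next
    case (insert g H)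
    have c: "unit_hom K B (c h) \<otimes>\<^bsub>B\<^esub> h \<in> carrier B" if "h \<in> insert g H" for h
      using that insert.prems G(2) \<open>c \<in> G \<rightarrow> carrier K\<close> by (intro B.m_closed unit_closed) auto
    then have "(\<Oplus>\<^bsub>B\<^esub>h\<in>insert g H. unit_hom K B (c h) \<otimes>\<^bsub>B\<^esub> h) =
      unit_hom K B (c g) \<otimes>\<^bsub>B\<^esub> g \<oplus>\<^bsub>B\<^esub> (\<Oplus>\<^bsub>B\<^esub>h\<in>H. unit_hom K B (c h) \<otimes>\<^bsub>B\<^esub> h)"
      using insert.hyps by (intro B.finsum_insert) auto
    moreover have "(\<Oplus>\<^bsub>B\<^esub>h\<in>H. unit_hom K B (c h) \<otimes>\<^bsub>B\<^esub> h) \<in> carrier B"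
      using c by (intro B.finsum_closed) auto
    moreover have "c g \<in> carrier K"
      using insert.prems that(1) by auto
    ultimately show ?case
      using add c[of g] insert gen_mem[of "c g" g] by (simp add: N.a_closed)
  qed
  have "\<mm> \<subseteq> Idl\<^bsub>B\<^esub> F"
  proof
    fix b assume b: "b \<in> \<mm>"
    then have bB: "b \<in> carrier B" and "\<epsilon> b = \<zero>\<^bsub>K\<^esub>"
      by (auto simp: \<mm>_def)
    then have "\<pi> b = b"
      using \<eta>.hom_zero by (simp add: \<pi>_def B.minus_eq)
    moreover obtain c where "c \<in> G \<rightarrow> carrier K" "b = (\<Oplus>\<^bsub>B\<^esub>g\<in>G. unit_hom K B (c g) \<otimes>\<^bsub>B\<^esub> g)"
      using gen[OF bB] by blast
    ultimately show "b \<in> Idl\<^bsub>B\<^esub> F"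
      using sum[of c G] by simp
  qed
  then show ?thesis
    using that F finite_imageI[OF G(1), of \<pi>] unfolding F_def by blast
qed

text \<open>
  Unramifiedness at \<open>y\<^sub>0\<close> says that the cotangent space \<open>\<mm>/\<mm>\<^sup>2\<close> is zero. The infinitesimal
  criterion is applied to the square-zero thickening \<open>Q = B/\<mm>\<^sup>2 \<rightarrow> K\<close> and to two
  points over \<open>Q\<close>: the tautological one \<open>x\<close> and the constant one \<open>y\<close>. Both lie over \<open>y\<^sub>0\<close> and
  reduce to \<open>y\<^sub>0\<close> in \<open>K\<close>; hence they coincide, so that \<open>B \<rightarrow> Q\<close> factors through \<open>\<epsilon>\<close> and kills \<open>\<mm>\<close>.
\<close>

lemma \<mm>_subset_square:
  assumes "unramified_over K Y Y y\<^sub>0 s"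
  shows "\<mm> \<subseteq> ideal_prod B \<mm> \<mm>"
proof -
  obtain U where U: "open_subfunctor K Y U" and y\<^sub>0U: "y\<^sub>0 \<in> U (base_alg K)"
    and unram: "formally_unramified_on K Y U s"
    using assms[unfolded unramified_over_def, rule_format, OF base(1) y\<^sub>0] base(2) s_y\<^sub>0 base_pt_base
    by auto
  obtain Q q where Q: "Q \<in> kalgs K" and q: "q \<in> kalg_hom K B Q" and surj: "q ` carrier B = carrier Q"
    and ker: "\<And>b. b \<in> carrier B \<Longrightarrow> q b = \<zero>\<^bsub>Q\<^esub> \<longleftrightarrow> b \<in> ideal_prod B \<mm> \<mm>"
    using quotient_kalg_exists[OF B B.ideal_prod_is_ideal[OF \<mm>_ideal \<mm>_ideal]] by blast
  have sub: "ideal_prod B \<mm> \<mm> \<subseteq> \<mm>"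
    using B.ideal_prod_inter[OF \<mm>_ideal \<mm>_ideal] by blast
  have ker_\<epsilon>: "\<epsilon> b = \<zero>\<^bsub>base_alg K\<^esub>" if "b \<in> carrier B" "q b = \<zero>\<^bsub>Q\<^esub>" for b
    using that ker sub by (auto simp: \<mm>_def)
  obtain p where p: "p \<in> kalg_hom K Q (base_alg K)" and pq: "\<And>b. b \<in> carrier B \<Longrightarrow> p (q b) = \<epsilon> b"
  proof (rule kalg_hom_factor[OF B Q base(1) q surj \<epsilon>_hom ker_\<epsilon>])
  qed (assumption | blast)+
  interpret q: ring_hom_cring B Q q
    using B Q q by (rule kalg_hom_ring_hom_cring)
  have p_surj: "p ` carrier Q = carrier (base_alg K)"
  proof -
    have "k \<in> p ` carrier Q" if "k \<in> carrier K" for k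
    proof -
      have "k = p (q (unit_hom K B k))"
        using that pq[of "unit_hom K B k"] \<epsilon>_unit[of k] by simp
      then show ?thesis
        using that q.hom_closed[of "unit_hom K B k"] by auto
    qed
    then show ?thesis
      using kalg_hom_closed[OF p] by auto
  qed
  have square_zero: "a \<otimes>\<^bsub>Q\<^esub> b = \<zero>\<^bsub>Q\<^esub>"
    if ab: "a \<in> carrier Q" "b \<in> carrier Q" "p a = \<zero>\<^bsub>base_alg K\<^esub>" "p b = \<zero>\<^bsub>base_alg K\<^esub>" for a b
  proof -
    obtain a' where a': "a' \<in> carrier B" "a = q a'"
      using ab(1) surj by blast
    obtain b' where b': "b' \<in> carrier B" "b = q b'"
      using ab(2) surj by blast
    have "a' \<in> \<mm>" "b' \<in> \<mm>"
      using ab(3,4) a' b' pq by (auto simp: \<mm>_def)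
    then have "a' \<otimes>\<^bsub>B\<^esub> b' \<in> ideal_prod B \<mm> \<mm>"
      by (rule ideal_prod.prod)
    then have "q (a' \<otimes>\<^bsub>B\<^esub> b') = \<zero>\<^bsub>Q\<^esub>"
      using ker[OF B.m_closed[OF a'(1) b'(1)]] by simp
    then show ?thesis
      using a' b' by simp
  qed
  \<comment> \<open>The quotient map and the augmentation followed by \<open>K \<rightarrow> Q\<close>, seen as points of \<open>Y\<close>.\<close>
  define x where "x = arr Y B Q q z"
  define y where "y = base_pt K Y y\<^sub>0 Q"
  have xF: "x \<in> pts X\<^sub>s Q"
    using kfunctor_arr_closed[OF fibre_kfunctor B Q q z] by (simp add: x_def)
  have x: "x \<in> pts Y Q" "s Q x = y"
    using xF by (simp_all add: fibre_iff y_def)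
  have px: "arr Y Q (base_alg K) p x = y\<^sub>0"
  proof -
    have "compose (carrier B) p q = \<epsilon>"
      using pq kalg_hom_compose[OF B q p] \<epsilon>_hom by (intro kalg_hom_eqI) (auto simp: compose_def)
    then have "arr X\<^sub>s Q (base_alg K) p x = arr X\<^sub>s B (base_alg K) \<epsilon> z"
      using kfunctor_arr_compose[OF fibre_kfunctor B Q base(1) q p z] by (simp add: x_def)
    then show ?thesis
      using arr_coord[OF base(1) y\<^sub>0_in_fibre] by (simp add: \<epsilon>_def)
  qed
  have py: "arr Y Q (base_alg K) p y = y\<^sub>0"
    using arr_base_pt[OF Q base(1) p] by (simp add: y_def base_pt_base)
  have xU: "x \<in> U Q"
    using open_subfunctor_thickening[OF Y U Q base(1) p p_surj square_zero x(1)] px y\<^sub>0U by simp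
  have yU: "y \<in> U Q"
    using U y\<^sub>0U base(1) Q unit_hom_kalg_hom[OF Q]
    unfolding y_def base_pt_def open_subfunctor_def subfunctor_def by blast
  have sy: "s Q y = y"
    using s_base_pt[OF Q] by (simp add: y_def)
  have "x = y"
    using unram[unfolded formally_unramified_on_def, rule_format, OF Q base(1) p _ xU yU]
      p_surj square_zero px py x(2) sy by simp
  have "coord Q x = q"
    using coord_eqI[OF Q q] by (simp add: x_def)
  moreover have "coord Q y = compose (carrier B) (unit_hom K Q) \<epsilon>"
    using coord_arr[OF base(1) Q unit_hom_kalg_hom[OF Q] y\<^sub>0_in_fibre]
    by (simp add: y_def base_pt_def \<epsilon>_def)
  ultimately have q_eq: "q = compose (carrier B) (unit_hom K Q) \<epsilon>"
    using \<open>x = y\<close> by simp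
  interpret u: ring_hom_cring "base_alg K" Q "unit_hom K Q"
    using base(1) Q unit_hom_kalg_hom[OF Q] by (rule kalg_hom_ring_hom_cring)
  show ?thesis
  proof
    fix b assume "b \<in> \<mm>"
    then have b: "b \<in> carrier B" "\<epsilon> b = \<zero>\<^bsub>K\<^esub>"
      by (auto simp: \<mm>_def)
    then have "q b = \<zero>\<^bsub>Q\<^esub>"
      using u.hom_zero by (simp add: q_eq compose_def)
    then show "b \<in> ideal_prod B \<mm> \<mm>"
      using ker b(1) by blast
  qed
qed

lemma coord_kills_\<mm>:
  assumes A: "A \<in> kalgs K" and w: "w \<in> pts X\<^sub>s A" and kill: "\<And>b. b \<in> \<mm> \<Longrightarrow> coord A w b = \<zero>\<^bsub>A\<^esub>"
  shows "w = base_pt K Y y\<^sub>0 A"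
proof -
  interpret c: ring_hom_cring B A "coord A w"
    using A w by (rule coord_ring_hom_cring)
  have u: "coord A w (unit_hom K B k) = unit_hom K A k" if "k \<in> carrier K" for k
    using fun_cong[OF base_alg_hom_unique[OF K.is_cring kalg_hom_compose[OF base(1)
      unit_hom_kalg_hom[OF B] coord_hom[OF A w]]], of k] that by (simp add: compose_def)
  have "coord A w = compose (carrier B) (unit_hom K A) \<epsilon>"
  proof (rule kalg_hom_eqI[OF coord_hom[OF A w]
      kalg_hom_compose[OF B \<epsilon>_hom unit_hom_kalg_hom[OF A]]])
    fix b assume b: "b \<in> carrier B"
    have "coord A w b \<ominus>\<^bsub>A\<^esub> coord A w (unit_hom K B (\<epsilon> b)) = \<zero>\<^bsub>A\<^esub>"
      using kill[OF diff_in_\<mm>[OF b]] b by (simp add: B.minus_eq c.S.minus_eq)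
    then show "coord A w b = compose (carrier B) (unit_hom K A) \<epsilon> b"
      using b u kalg_hom_closed[OF unit_hom_kalg_hom[OF A], of "\<epsilon> b"] by (simp add: compose_def)
  qed
  also have "\<dots> = coord A (base_pt K Y y\<^sub>0 A)"
    using coord_arr[OF base(1) A unit_hom_kalg_hom[OF A] y\<^sub>0_in_fibre]
    by (simp add: base_pt_def \<epsilon>_def)
  finally show ?thesis
    using arr_coord[OF A w] arr_coord[OF A base_pt_in_fibre[OF A]] by simp
qed

end

context pointed_endo
begin

text \<open>
  The geometric heart: \<open>\<mm>\<close> is generated by an idempotent \<open>e\<close>, so \<open>{y\<^sub>0}\<close> is the open and
  closed subscheme \<open>D(1 - e)\<close> of the fibre, with coordinate ring \<open>B/\<mm> = K\<close>. Connected
  components are taken in the topological space, but the conclusion is about all \<open>A\<close>-valued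
  points, nilpotents included: the component is a reduced rational point.
\<close>

lemma base_component_eq_base_pt:
  assumes fin: "finite_mor K Y Y s" and unram: "unramified_over K Y Y y\<^sub>0 s" and A: "A \<in> kalgs K"
  shows "base_component K Y y\<^sub>0 s A = {base_pt K Y y\<^sub>0 A}"
proof -
  obtain B z where aff: "affine_functor K X\<^sub>s B z" and mf: "module_finite (base_alg K) B (unit_hom K B)"
    using finite_imp_affine_fibre[OF fin] .
  interpret affine_fibre K Y y\<^sub>0 s B z
    using aff by (simp add: affine_fibre_def pointed_endo_axioms)
  obtain F where "finite F" "F \<subseteq> \<mm>" "\<mm> \<subseteq> Idl\<^bsub>B\<^esub> F"
    using \<mm>_finitely_generated[OF mf] .
  then obtain e where e: "e \<in> \<mm>" "\<And>b. b \<in> \<mm> \<Longrightarrow> e \<otimes>\<^bsub>B\<^esub> b = b"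
    using B.idempotent_ideal_has_unit[OF \<mm>_ideal \<mm>_subset_square[OF unram]] by blast
  have eB: "e \<in> carrier B" "e \<otimes>\<^bsub>B\<^esub> e = e" "coord (base_alg K) y\<^sub>0 e = \<zero>\<^bsub>base_alg K\<^esub>"
    using e by (auto simp: \<mm>_def \<epsilon>_def)
  show ?thesis
  proof (intro equalityI subsetI)
    fix w assume w: "w \<in> base_component K Y y\<^sub>0 s A"
    then have wX: "w \<in> pts X\<^sub>s A"
      by (simp add: base_component_def sub_on_def)
    interpret c: ring_hom_cring B A "coord A w"
      using A wX by (rule coord_ring_hom_cring)
    have "coord A w e = \<zero>\<^bsub>A\<^esub>"
      using connected_component_kills_idempotent[OF eB(1,2) base y\<^sub>0_in_fibre eB(3) A]
        w by (simp add: base_component_def)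
    then have "coord A w b = \<zero>\<^bsub>A\<^esub>" if "b \<in> \<mm>" for b
      using e(2)[OF that] c.hom_mult[OF eB(1) \<mm>_carrier[OF that]] \<mm>_carrier[OF that] by simp
    then show "w \<in> {base_pt K Y y\<^sub>0 A}"
      using coord_kills_\<mm>[OF A wX] by blast
  next
    fix w assume "w \<in> {base_pt K Y y\<^sub>0 A}"
    \<comment> \<open>Conversely, all field-valued specialisations of the base point represent the same point.\<close>
    moreover have "point_of K X\<^sub>s L (arr X\<^sub>s A L h (base_pt K Y y\<^sub>0 A)) = point_of K X\<^sub>s (base_alg K) y\<^sub>0"
      if "L \<in> kalgs K" "field L" "h \<in> kalg_hom K A L" for L h
      using point_of_arr[OF base that(1,2) unit_hom_kalg_hom[OF that(1)] y\<^sub>0_in_fibre]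
        arr_base_pt[OF A that(1,3)] by (simp add: base_pt_def)
    moreover have "connected_component_of (space_of K X\<^sub>s) (point_of K X\<^sub>s (base_alg K) y\<^sub>0)
        (point_of K X\<^sub>s (base_alg K) y\<^sub>0)"
      using point_in_topspace[OF base y\<^sub>0_in_fibre] by (simp add: connected_component_of_refl)
    ultimately show "w \<in> base_component K Y y\<^sub>0 s A"
      using base_pt_in_fibre[OF A] by (simp add: base_component_def sub_on_def)
  qed
qed

end

section \<open>The partial isomorphisms of the limit\<close>

locale pointed_tower = pointed_functor K Y y\<^sub>0
  for K :: "'a ring" and Y :: "('a, 'p) kfunctor" and y\<^sub>0 :: 'p +
  fixes S :: "('a kalg \<Rightarrow> 'p \<Rightarrow> 'p) set"
  assumes S: "endo_semigroup K Y y\<^sub>0 S"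
begin

abbreviation X :: "('a, ('a kalg \<Rightarrow> 'p \<Rightarrow> 'p) \<Rightarrow> 'p) kfunctor" where
  "X \<equiv> tower_limit K Y y\<^sub>0 S"

lemma S_mor: "s \<in> S \<Longrightarrow> s \<in> mor K Y Y"
  using S by (auto simp: endo_semigroup_def)

lemma S_pointed_endo: "s \<in> S \<Longrightarrow> pointed_endo K Y y\<^sub>0 s"
  using S S_mor pointed_functor_axioms
  by (simp add: pointed_endo_def pointed_endo_axioms_def endo_semigroup_def)

lemma S_comm_monoid: "comm_monoid \<lparr>carrier = S, monoid.mult = mor_comp Y, one = mor_id Y\<rparr>"
  using S by (simp add: endo_semigroup_def)

lemma S_comp: "s \<in> S \<Longrightarrow> t \<in> S \<Longrightarrow> mor_comp Y s t \<in> S"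
  using monoid.m_closed[OF comm_monoid.axioms(1)[OF S_comm_monoid]] by simp

lemma S_comm: "s \<in> S \<Longrightarrow> t \<in> S \<Longrightarrow> mor_comp Y s t = mor_comp Y t s"
  using comm_monoid.m_comm[OF S_comm_monoid] by simp

lemma S_assoc: "s \<in> S \<Longrightarrow> t \<in> S \<Longrightarrow> u \<in> S \<Longrightarrow>
    mor_comp Y (mor_comp Y s t) u = mor_comp Y s (mor_comp Y t u)"
  using monoid.m_assoc[OF comm_monoid.axioms(1)[OF S_comm_monoid]] by simp

lemma S_apply_comm:
  assumes "s \<in> S" "t \<in> S" "y \<in> pts Y A"
  shows "s A (t A y) = t A (s A y)"
  using fun_cong[OF fun_cong[OF S_comm[OF assms(1,2)]], of A y] assms(3)
  by (simp add: mor_comp_apply)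

lemma limit_iff:
  "x \<in> pts X A \<longleftrightarrow> A \<in> kalgs K \<and> x \<in> extensional S \<and>
    (\<forall>s\<in>S. x s \<in> pts Y A \<and> s A (x s) = base_pt K Y y\<^sub>0 A) \<and>
    (\<forall>s\<in>S. \<forall>r\<in>S. r A (x (mor_comp Y s r)) = x s)"
proof -
  have transition: "transition K Y y\<^sub>0 s r A (x (mor_comp Y s r)) = r A (x (mor_comp Y s r))"
    if "x \<in> (\<Pi>\<^sub>E s\<in>S. pts (fibre K Y y\<^sub>0 s) A)" "s \<in> S" "r \<in> S" for s r
    using PiE_mem[OF that(1) S_comp[OF that(2,3)]] by (simp add: transition_def)
  have "x \<in> pts X A \<longleftrightarrow> A \<in> kalgs K \<and> x \<in> (\<Pi>\<^sub>E s\<in>S. pts (fibre K Y y\<^sub>0 s) A) \<and>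
      (\<forall>s\<in>S. \<forall>r\<in>S. transition K Y y\<^sub>0 s r A (x (mor_comp Y s r)) = x s)"
    by (simp add: tower_limit_def)
  also have "\<dots> \<longleftrightarrow> A \<in> kalgs K \<and> x \<in> (\<Pi>\<^sub>E s\<in>S. pts (fibre K Y y\<^sub>0 s) A) \<and>
      (\<forall>s\<in>S. \<forall>r\<in>S. r A (x (mor_comp Y s r)) = x s)"
    using transition by (intro conj_cong refl ball_cong) simp
  also have "x \<in> (\<Pi>\<^sub>E s\<in>S. pts (fibre K Y y\<^sub>0 s) A) \<longleftrightarrow> x \<in> extensional S \<and>
      (\<forall>s\<in>S. x s \<in> pts Y A \<and> s A (x s) = base_pt K Y y\<^sub>0 A)"
    by (auto simp: fibre_def PiE_iff)
  finally show ?thesis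
    by simp
qed

lemma limitI:
  assumes "A \<in> kalgs K" "x \<in> extensional S" "\<And>s. s \<in> S \<Longrightarrow> x s \<in> pts Y A"
    "\<And>s. s \<in> S \<Longrightarrow> s A (x s) = base_pt K Y y\<^sub>0 A"
    "\<And>s r. s \<in> S \<Longrightarrow> r \<in> S \<Longrightarrow> r A (x (mor_comp Y s r)) = x s"
  shows "x \<in> pts X A"
  unfolding limit_iff using assms by blast

lemma limit_kalgs: "x \<in> pts X A \<Longrightarrow> A \<in> kalgs K"
  and limit_closed: "x \<in> pts X A \<Longrightarrow> s \<in> S \<Longrightarrow> x s \<in> pts Y A"
  and limit_fibre: "x \<in> pts X A \<Longrightarrow> s \<in> S \<Longrightarrow> s A (x s) = base_pt K Y y\<^sub>0 A"
  and limit_compatible: "x \<in> pts X A \<Longrightarrow> s \<in> S \<Longrightarrow> r \<in> S \<Longrightarrow> r A (x (mor_comp Y s r)) = x s"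
  and limit_extensional: "x \<in> pts X A \<Longrightarrow> x \<in> extensional S"
  unfolding limit_iff by blast+

lemma limit_compatible':
  "x \<in> pts X A \<Longrightarrow> s \<in> S \<Longrightarrow> r \<in> S \<Longrightarrow> s A (x (mor_comp Y s r)) = x r"
  using limit_compatible[of x A r s] S_comm[of s r] by simp

lemma limit_arr: "s \<in> S \<Longrightarrow> arr X A B h x s = arr Y A B h (x s)"
  by (simp add: tower_limit_def)

lemma limit_arr_restrict: "arr X A B h x = (\<lambda>s\<in>S. arr Y A B h (x s))"
  by (simp add: tower_limit_def)

lemma limit_arr_closed:
  assumes "A \<in> kalgs K" "B \<in> kalgs K" "h \<in> kalg_hom K A B" "x \<in> pts X A"
  shows "arr X A B h x \<in> pts X B"
proof -
  have nat: "s B (arr Y A B h (x t)) = arr Y A B h (s A (x t))" if "s \<in> S" "t \<in> S" for s t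
    using mor_natural[OF S_mor[OF that(1)] assms(1-3)] limit_closed[OF assms(4) that(2)] by simp
  show ?thesis
  proof (rule limitI[OF assms(2)])
    show "arr X A B h x \<in> extensional S"
      by (simp add: limit_arr_restrict)
  next
    fix s assume s: "s \<in> S"
    show "arr X A B h x s \<in> pts Y B"
      using kfunctor_arr_closed[OF Y assms(1-3) limit_closed[OF assms(4) s]] by (simp add: limit_arr s)
    show "s B (arr X A B h x s) = base_pt K Y y\<^sub>0 B"
      using nat[OF s s] limit_fibre[OF assms(4) s] arr_base_pt[OF assms(1-3)] by (simp add: limit_arr s)
  next
    fix s r assume sr: "s \<in> S" "r \<in> S"
    show "r B (arr X A B h x (mor_comp Y s r)) = arr X A B h x s"
      using nat[OF sr(2) S_comp[OF sr]] limit_compatible[OF assms(4) sr] sr S_comp[OF sr]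
      by (simp add: limit_arr)
  qed
qed

lemma proj_apply: "x \<in> pts X A \<Longrightarrow> proj K Y y\<^sub>0 S s A x = x s"
  by (simp add: proj_def)

text \<open>
  This formula is forced: \<open>\<xi>\<^sub>v(\<beta>\<^sub>s(x))\<close> is the image under \<open>s\<close> of \<open>\<xi>\<^sub>s\<^sub>v(\<beta>\<^sub>s(x))\<close> because \<open>sv = vs\<close>, and the latter is to
  be \<open>\<xi>\<^sub>v(x)\<close>. It defines a point of the limit since all elements of \<open>S\<close> commute and fix
  \<open>y\<^sub>0\<close>.
\<close>

definition \<beta> ::
  "('a kalg \<Rightarrow> 'p \<Rightarrow> 'p) \<Rightarrow> 'a kalg \<Rightarrow> (('a kalg \<Rightarrow> 'p \<Rightarrow> 'p) \<Rightarrow> 'p) \<Rightarrow> ('a kalg \<Rightarrow> 'p \<Rightarrow> 'p) \<Rightarrow> 'p"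
  where "\<beta> s = (\<lambda>A. \<lambda>x\<in>pts X A. \<lambda>v\<in>S. s A (x v))"

lemma \<beta>_apply: "x \<in> pts X A \<Longrightarrow> v \<in> S \<Longrightarrow> \<beta> s A x v = s A (x v)"
  by (simp add: \<beta>_def)

lemma \<beta>_closed:
  assumes s: "s \<in> S" and x: "x \<in> pts X A"
  shows "\<beta> s A x \<in> pts X A"
proof -
  interpret s: pointed_endo K Y y\<^sub>0 s
    using S_pointed_endo[OF s] .
  show ?thesis
  proof (rule limitI[OF limit_kalgs[OF x]])
    show "\<beta> s A x \<in> extensional S"
      using x by (simp add: \<beta>_def)
  next
    fix v assume v: "v \<in> S"
    show "\<beta> s A x v \<in> pts Y A"
      using mor_closed[OF S_mor[OF s] limit_closed[OF x v]] by (simp add: \<beta>_apply x v)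
    show "v A (\<beta> s A x v) = base_pt K Y y\<^sub>0 A"
      using S_apply_comm[OF v s limit_closed[OF x v]] limit_fibre[OF x v]
        s.s_base_pt[OF limit_kalgs[OF x]] by (simp add: \<beta>_apply x v)
  next
    fix v r assume vr: "v \<in> S" "r \<in> S"
    show "r A (\<beta> s A x (mor_comp Y v r)) = \<beta> s A x v"
      using S_apply_comm[OF vr(2) s limit_closed[OF x S_comp[OF vr]]] limit_compatible[OF x vr]
      by (simp add: \<beta>_apply x vr S_comp[OF vr])
  qed
qed

lemma \<beta>_natural:
  assumes s: "s \<in> S" and AB: "A \<in> kalgs K" "B \<in> kalgs K" "h \<in> kalg_hom K A B" and x: "x \<in> pts X A"
  shows "\<beta> s B (arr X A B h x) = arr X A B h (\<beta> s A x)"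
proof (rule extensionalityI[of _ S])
  show "\<beta> s B (arr X A B h x) \<in> extensional S"
    using limit_extensional[OF \<beta>_closed[OF s limit_arr_closed[OF AB x]]] .
  show "arr X A B h (\<beta> s A x) \<in> extensional S"
    using limit_extensional[OF limit_arr_closed[OF AB \<beta>_closed[OF s x]]] .
  fix v assume v: "v \<in> S"
  show "\<beta> s B (arr X A B h x) v = arr X A B h (\<beta> s A x) v"
    using limit_arr_closed[OF AB x] x v mor_natural[OF S_mor[OF s] AB limit_closed[OF x v]]
    by (simp add: \<beta>_apply limit_arr)
qed

lemma \<beta>_mor: "s \<in> S \<Longrightarrow> \<beta> s \<in> mor K X X"
  using \<beta>_closed \<beta>_natural unfolding mor_def by (auto simp: PiE_iff \<beta>_def)

lemma \<beta>_limit_property: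
  assumes "s \<in> S"
  shows "limit_property K Y y\<^sub>0 S s (\<beta> s)"
proof -
  have "\<beta> s A x (mor_comp Y s u) = x u" if "u \<in> S" "x \<in> pts X A" for u A x
    using limit_compatible'[OF that(2) assms that(1)] by (simp add: \<beta>_apply that S_comp[OF assms])
  then show ?thesis
    using \<beta>_closed[OF assms] by (simp add: limit_property_def proj_apply)
qed

lemma \<beta>_unique:
  assumes s: "s \<in> S" and \<gamma>: "\<gamma> \<in> mor K X X" and limit: "limit_property K Y y\<^sub>0 S s \<gamma>"
  shows "\<gamma> = \<beta> s"
proof (rule mor_eqI[OF \<gamma> \<beta>_mor[OF s]])
  fix A x assume x: "x \<in> pts X A"
  have \<gamma>x: "\<gamma> A x \<in> pts X A"
    using mor_closed[OF \<gamma> x] .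
  show "\<gamma> A x = \<beta> s A x"
  proof (rule extensionalityI[OF limit_extensional[OF \<gamma>x] limit_extensional[OF \<beta>_closed[OF s x]]])
    fix v assume v: "v \<in> S"
    have "\<gamma> A x v = s A (\<gamma> A x (mor_comp Y s v))"
      using limit_compatible'[OF \<gamma>x s v] by simp
    also have "\<gamma> A x (mor_comp Y s v) = x v"
      using limit[unfolded limit_property_def, rule_format, OF v limit_kalgs[OF x] x]
      by (simp add: proj_apply x \<gamma>x)
    finally show "\<gamma> A x v = \<beta> s A x v"
      using x v by (simp add: \<beta>_apply)
  qed
qed

lemma \<beta>_id: "\<beta> (mor_id Y) = mor_id X"
proof (rule ext, rule ext)
  fix A x
  show "\<beta> (mor_id Y) A x = mor_id X A x"
  proof (cases "x \<in> pts X A")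
    case True
    then have "\<beta> (mor_id Y) A x = restrict x S"
      by (auto simp: \<beta>_def mor_id_def limit_closed intro!: restrict_ext)
    also have "\<dots> = x"
      using limit_extensional[OF True] by (rule extensional_restrict)
    finally show ?thesis
      using True by (simp add: mor_id_def)
  next
    case False
    then show ?thesis
      by (simp add: \<beta>_def mor_id_def)
  qed
qed

lemma \<beta>_comp:
  assumes "s \<in> S" "t \<in> S"
  shows "\<beta> (mor_comp Y s t) = mor_comp X (\<beta> s) (\<beta> t)"
proof (intro ext)
  fix A x v
  show "\<beta> (mor_comp Y s t) A x v = mor_comp X (\<beta> s) (\<beta> t) A x v"
    using limit_closed[of x A v] \<beta>_closed[OF assms(2), of x A]
    by (auto simp: \<beta>_def mor_comp_def compose_def restrict_def)
qed

text \<open>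
  The inverse of \<open>\<beta>\<^sub>s\<close>. The coordinate \<open>x\<^sub>s\<^sub>u\<close> lies in \<open>X\<^sub>s\<^sub>u\<close> only, and it lies in the smaller fibre
  \<open>X\<^sub>u\<close> exactly if its image \<open>u(x\<^sub>s\<^sub>u) = x\<^sub>s\<close> is the base point.
\<close>

definition shift ::
  "('a kalg \<Rightarrow> 'p \<Rightarrow> 'p) \<Rightarrow> (('a kalg \<Rightarrow> 'p \<Rightarrow> 'p) \<Rightarrow> 'p) \<Rightarrow> ('a kalg \<Rightarrow> 'p \<Rightarrow> 'p) \<Rightarrow> 'p"
  where "shift s x = (\<lambda>u\<in>S. x (mor_comp Y s u))"

lemma shift_closed:
  assumes s: "s \<in> S" and x: "x \<in> pts X A" "x s = base_pt K Y y\<^sub>0 A"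
  shows "shift s x \<in> pts X A"
proof (rule limitI[OF limit_kalgs[OF x(1)]])
  show "shift s x \<in> extensional S"
    by (simp add: shift_def)
next
  fix u assume u: "u \<in> S"
  show "shift s x u \<in> pts Y A"
    using limit_closed[OF x(1) S_comp[OF s u]] by (simp add: shift_def u)
  show "u A (shift s x u) = base_pt K Y y\<^sub>0 A"
    using limit_compatible[OF x(1) s u] x(2) by (simp add: shift_def u)
next
  fix u r assume ur: "u \<in> S" "r \<in> S"
  show "r A (shift s x (mor_comp Y u r)) = shift s x u"
    using limit_compatible[OF x(1) S_comp[OF s ur(1)] ur(2)] S_assoc[OF s ur]
    by (simp add: shift_def ur S_comp[OF ur])
qed

lemma \<beta>_shift:
  assumes s: "s \<in> S" and x: "x \<in> pts X A" "x s = base_pt K Y y\<^sub>0 A"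
  shows "\<beta> s A (shift s x) = x"
proof -
  have shift: "shift s x \<in> pts X A"
    using shift_closed[of s x A] assms by simp
  show ?thesis
  proof (rule extensionalityI[OF _ limit_extensional[OF x(1)]])
    show "\<beta> s A (shift s x) \<in> extensional S"
      using limit_extensional[OF \<beta>_closed[OF s shift]] .
    show "\<beta> s A (shift s x) v = x v" if "v \<in> S" for v
      using that limit_compatible'[OF x(1) s that] shift
      by (simp add: \<beta>_apply) (simp add: shift_def)
  qed
qed

lemma shift_\<beta>:
  assumes s: "s \<in> S" and x: "x \<in> pts X A"
  shows "shift s (\<beta> s A x) = x"
proof (rule extensionalityI[OF _ limit_extensional[OF x]])
  show "shift s (\<beta> s A x) \<in> extensional S"
    by (simp add: shift_def)
  show "shift s (\<beta> s A x) v = x v" if "v \<in> S" for v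
    using that x s S_comp limit_compatible'[OF x s that] by (simp add: shift_def \<beta>_apply)
qed

lemma \<beta>_mor_iso:
  assumes s: "s \<in> S" and U: "\<And>A. U A = {x \<in> pts X A. x s = base_pt K Y y\<^sub>0 A}"
  shows "mor_iso K X (restr X U) (\<beta> s)"
  unfolding mor_iso_def
proof (intro conjI bexI)
  have \<beta>_U: "\<beta> s A x \<in> U A" if "x \<in> pts X A" for A x
    using \<beta>_closed[OF s that] limit_fibre[OF that s] s that by (simp add: U \<beta>_apply)
  show "\<beta> s \<in> mor K X (restr X U)"
    using \<beta>_U \<beta>_natural[OF s] unfolding mor_def by (auto simp: PiE_iff \<beta>_def)
  define \<theta> where "\<theta> = (\<lambda>A. \<lambda>x\<in>U A. shift s x)"
  show "\<theta> \<in> mor K (restr X U) X"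
  proof -
    have "\<theta> B (arr X A B h x) = arr X A B h (\<theta> A x)"
      if AB: "A \<in> kalgs K" "B \<in> kalgs K" "h \<in> kalg_hom K A B" and x: "x \<in> U A" for A B h x
    proof -
      have "arr X A B h x \<in> U B"
        using limit_arr_closed[OF AB] arr_base_pt[OF AB] x s by (simp add: U limit_arr)
      then show ?thesis
        using x S_comp[OF s] by (auto simp: \<theta>_def shift_def limit_arr_restrict)
    qed
    then show ?thesis
      unfolding mor_def using shift_closed[of s, OF s] by (auto simp: PiE_iff \<theta>_def U)
  qed
  show "mor_comp X \<theta> (\<beta> s) = mor_id X"
    using \<beta>_U shift_\<beta>[OF s]
    by (auto simp: mor_comp_def mor_id_def compose_def \<theta>_def intro!: ext)
  show "mor_comp (restr X U) (\<beta> s) \<theta> = mor_id (restr X U)"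
    using \<beta>_shift[of s, OF s]
    by (auto simp: mor_comp_def mor_id_def compose_def \<theta>_def U intro!: ext)
qed

text \<open>
  As \<open>Z\<^sub>s\<close> is the single reduced point \<open>y\<^sub>0\<close>, its inverse image under \<open>\<xi>\<^sub>s\<close> is the fibre of \<open>\<xi>\<^sub>s\<close>
  over \<open>y\<^sub>0\<close>, which is the image of \<open>\<beta>\<^sub>s\<close>.
\<close>

lemma \<beta>_mor_iso_limit_part:
  assumes s: "s \<in> S" and fin: "finite_mor K Y Y s" and unram: "unramified_over K Y Y y\<^sub>0 s"
  shows "mor_iso K X (limit_part K Y y\<^sub>0 S s) (\<beta> s)"
  unfolding limit_part_def
proof (rule \<beta>_mor_iso[OF s])
  interpret s: pointed_endo K Y y\<^sub>0 s
    using S_pointed_endo[OF s] .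
  show "{x \<in> pts X A. proj K Y y\<^sub>0 S s A x \<in> base_component K Y y\<^sub>0 s A} =
      {x \<in> pts X A. x s = base_pt K Y y\<^sub>0 A}" for A
  proof (cases "A \<in> kalgs K")
    case True
    then show ?thesis
      by (auto simp: proj_apply s.base_component_eq_base_pt[OF fin unram])
  next
    case False
    then show ?thesis
      using limit_kalgs by blast
  qed
qed

end

theorem proposition3p5:
  fixes K :: "'a ring"
    and Y :: "('a, 'p) kfunctor"
    and y\<^sub>0 :: 'p
    and S :: "('a kalg \<Rightarrow> 'p \<Rightarrow> 'p) set"
  assumes "infinite (UNIV :: 'a set)"
    and "field K"
    and "variety K Y"
    and "y\<^sub>0 \<in> pts Y (base_alg K)"
    and "endo_semigroup K Y y\<^sub>0 S"
    and "countable S"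
    and "\<And>s. s \<in> S \<Longrightarrow> finite_mor K Y Y s"
    and "\<And>s. s \<in> S \<Longrightarrow> unramified_over K Y Y y\<^sub>0 s"
  defines "X \<equiv> tower_limit K Y y\<^sub>0 S"
  shows "\<exists>\<beta>.
    (\<forall>s\<in>S. mor_iso K X (limit_part K Y y\<^sub>0 S s) (\<beta> s) \<and>
       limit_property K Y y\<^sub>0 S s (\<beta> s) \<and>
       (\<forall>\<gamma>\<in>mor K X X. limit_property K Y y\<^sub>0 S s \<gamma> \<longrightarrow> \<gamma> = \<beta> s)) \<and>
    \<beta> (mor_id Y) = mor_id X \<and>
    (\<forall>s\<in>S. \<forall>t\<in>S. \<beta> (mor_comp Y s t) = mor_comp X (\<beta> s) (\<beta> t))"
proof -
  have "is_kfunctor K Y"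
    using assms(3) by (simp add: variety_def scheme_def)
  then interpret pointed_tower K Y y\<^sub>0 S
    using assms(2,4,5) by (intro pointed_tower.intro pointed_functor.intro pointed_tower_axioms.intro)
  show ?thesis
    unfolding X_def
  proof (rule exI[of _ \<beta>], intro conjI ballI impI)
    fix s assume s: "s \<in> S"
    show "mor_iso K (tower_limit K Y y\<^sub>0 S) (limit_part K Y y\<^sub>0 S s) (\<beta> s)"
      using \<beta>_mor_iso_limit_part[OF s] assms(7,8) s by blast
    show "limit_property K Y y\<^sub>0 S s (\<beta> s)"
      using \<beta>_limit_property[OF s] .
    show "\<gamma> = \<beta> s" if "\<gamma> \<in> mor K (tower_limit K Y y\<^sub>0 S) (tower_limit K Y y\<^sub>0 S)"
      "limit_property K Y y\<^sub>0 S s \<gamma>" for \<gamma>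
      using \<beta>_unique[OF s that] .
    show "\<beta> (mor_comp Y s t) = mor_comp (tower_limit K Y y\<^sub>0 S) (\<beta> s) (\<beta> t)" if "t \<in> S" for t
      using \<beta>_comp[OF s that] .
  next
    show "\<beta> (mor_id Y) = mor_id (tower_limit K Y y\<^sub>0 S)"
      by (rule \<beta>_id)
  qed
qed

end
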